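(* Let $N\ge 3$ be an integer, $0<a<b$ and $A=\{x\in\mathbb{R}^N : a<|x|<b\}$. For any $p>1$, the problem $$-\Delta u=(N-2)^2\frac{u^p(x)}{|x|^{2(N-1)}}\ (x\in A),\qquad u(x)>0\ (x\in A),\qquad u(x)=0\ (x\in\partial A)$$ admits a unique radially symmetric solution $u_p(x)=u_p(|x|)$. Furthermore, as $p\to\infty$, $$u_p(|x|)\to\frac{2}{a^{2-N}-b^{2-N}}\begin{cases}a^{2-N}-|x|^{2-N}, & a\le|x|\le\left(\frac{a^{2-N}+b^{2-N}}{2}\right)^{\frac{1}{2-N}},\\ |x|^{2-N}-b^{2-N}, & \left(\frac{a^{2-N}+b^{2-N}}{2}\right)^{\frac{1}{2-N}}\le|x|\le b,\end{cases}$$ in $C^0(\overline{A})$, and, as $p\searrow 1$, $$u_p(|x|)=\left(\frac{2}{a^{2-N}-b^{2-N}}\right)^{\frac{2}{p-1}}\left(\frac{p+1}{2}\right)^{\frac{1}{p-1}}L_p^{\frac{2}{p-1}}\left[\sin\left(\frac{\pi(|x|^{2-N}-b^{2-N})}{a^{2-N}-b^{2-N}}\right)+o_p(1)\right]$$ in $C^0(\overline{A})$, where $o_p(1)$ denotes a function on $\overline{A}$ (depending on $p$) with $o_p(1)\to 0$ in $C^0(\overline{A})$ as $p\searrow 1$.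
   Context: For $p>0$, $L_p=\int_0^1\frac{ds}{\sqrt{1-s^{p+1}}}$. Solutions are understood in the classical sense, $u\in C^2(A)\cap C^0(\overline{A})$. Convergence in $C^0(\overline{A})$ means uniform convergence on $\overline{A}$. A radially symmetric function is identified with a function of $r=|x|$. *)

theory Defs
  imports "HOL-Analysis.Analysis"
begin

definition partially_differentiable ::
    "'n::finite \<Rightarrow> (real^'n \<Rightarrow> real) \<Rightarrow> real^'n \<Rightarrow> bool" where
  "partially_differentiable i u x \<longleftrightarrow>
     (\<lambda>t. u (x + t *\<^sub>R axis i 1)) field_differentiable (at 0)"

definition partial_deriv ::
    "'n::finite \<Rightarrow> (real^'n \<Rightarrow> real) \<Rightarrow> real^'n \<Rightarrow> real" where
  "partial_deriv i u x = deriv (\<lambda>t. u (x + t *\<^sub>R axis i 1)) 0"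

(* The C^1 and C^2 predicates below are meant for open S: at x in S the difference
   quotients use values of u at nearby points, which then also lie in S. *)

definition C1_on :: "(real^'n::finite) set \<Rightarrow> (real^'n \<Rightarrow> real) \<Rightarrow> bool" where
  "C1_on S u \<longleftrightarrow> continuous_on S u \<and>
     (\<forall>i. (\<forall>x\<in>S. partially_differentiable i u x) \<and> continuous_on S (partial_deriv i u))"

definition C2_on :: "(real^'n::finite) set \<Rightarrow> (real^'n \<Rightarrow> real) \<Rightarrow> bool" where
  "C2_on S u \<longleftrightarrow> C1_on S u \<and> (\<forall>i. C1_on S (partial_deriv i u))"

definition laplacian :: "(real^'n::finite \<Rightarrow> real) \<Rightarrow> real^'n \<Rightarrow> real" where
  "laplacian u x = (\<Sum>i\<in>UNIV. partial_deriv i (partial_deriv i u) x)"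

definition annulus :: "real \<Rightarrow> real \<Rightarrow> (real^'n::finite) set" where
  "annulus a b = {x. a < norm x \<and> norm x < b}"

(* Functions are total, so only the values of u on the closed annulus are constrained;
   uniqueness of a solution means equality on the closed annulus. *)

definition is_solution ::
    "real \<Rightarrow> real \<Rightarrow> real \<Rightarrow> (real^'n::finite \<Rightarrow> real) \<Rightarrow> bool" where
  "is_solution a b p u \<longleftrightarrow>
     C2_on (annulus a b) u \<and> continuous_on (closure (annulus a b)) u \<and>
     (\<forall>x\<in>annulus a b.
        - laplacian u x =
          (real CARD('n) - 2)\<^sup>2 * (u x powr p / norm x ^ (2 * (CARD('n) - 1)))) \<and>
     (\<forall>x\<in>annulus a b. u x > 0) \<and>
     (\<forall>x\<in>frontier (annulus a b). u x = 0)"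

definition radially_symmetric_on ::
    "(real^'n::finite) set \<Rightarrow> (real^'n \<Rightarrow> real) \<Rightarrow> bool" where
  "radially_symmetric_on S u \<longleftrightarrow> (\<exists>f :: real \<Rightarrow> real. \<forall>x\<in>S. u x = f (norm x))"

definition is_radial_solution ::
    "real \<Rightarrow> real \<Rightarrow> real \<Rightarrow> (real^'n::finite \<Rightarrow> real) \<Rightarrow> bool" where
  "is_radial_solution a b p u \<longleftrightarrow>
     is_solution a b p u \<and> radially_symmetric_on (closure (annulus a b)) u"

(* For p > 0. The integrand is singular at s = 1, where division by zero gives it the
   value 0; the Henstock-Kurzweil integral is the improper integral and ignores this point. *)

definition Lp :: "real \<Rightarrow> real" where
  "Lp p = integral {0..1} (\<lambda>s. 1 / sqrt (1 - s powr (p + 1)))"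

end

theory Submission
  imports Defs "HOL-Real_Asymp.Real_Asymp"
begin

text \<open>
  In the coordinate \<open>t = (r powr (2 - N) - b powr (2 - N)) / d\<close> with
  \<open>d = a powr (2 - N) - b powr (2 - N)\<close>, which is harmonic as a function of \<open>x\<close>, the radial
  Laplacian has no first order term: a radial \<open>u\<close> with \<open>u x = w t\<close> satisfies
  \<open>laplacian u x = (N - 2)\<^sup>2 / d\<^sup>2 * w'' t / r powr (2 * (N - 1))\<close>. The weight in the
  equation is chosen to cancel, so the boundary value problem becomes the autonomous equation
  \<open>- w'' = d\<^sup>2 * w powr p\<close> on the unit interval, with \<open>w 0 = w 1 = 0\<close> and \<open>w > 0\<close> inside.

  This equation is solved by quadrature. Let \<open>gen_arcsin p y\<close> be the integral of
  \<open>1 / sqrt (1 - s powr (p + 1))\<close> from \<open>0\<close> to \<open>y\<close>, so that \<open>gen_arcsin p 1 = Lp p\<close>. Its inverse,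
  stretched to the half interval and continued by reflection, is the \<open>profile\<close>: it has maximum
  \<open>1\<close>, attained at \<open>1/2\<close>, and its second derivative is
  \<open>- 2 * (p + 1) * (Lp p)\<^sup>2 * profile p t powr p\<close>. The power nonlinearity lets a multiple of the
  profile solve the equation with any positive constant in place of \<open>2 * (p + 1) * (Lp p)\<^sup>2\<close>;
  the multiple is the \<open>amplitude\<close>, which is the prefactor in the expansion as \<open>p\<close> decreases to \<open>1\<close>.
  Conversely, for an arbitrary positive solution \<open>w\<close> with maximum \<open>M\<close> at \<open>c\<close>, conservation of
  energy makes \<open>gen_arcsin p (w t / M)\<close> linear with the same absolute slope on both sides of
  \<open>c\<close>; as it reaches \<open>Lp p\<close> at \<open>c\<close> from both ends, \<open>c = 1/2\<close>, the slope is \<open>2 * Lp p\<close>, and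
  \<open>M\<close> and \<open>w\<close> are determined (\<open>lane_emden_unit_interval\<close>).

  Both limits come from comparing the derivative of \<open>gen_arcsin p\<close> with \<open>1\<close> from below and
  with the derivative of \<open>arcsin\<close> from above: the differences \<open>gen_arcsin p y - y\<close> and
  \<open>arcsin y - gen_arcsin p y\<close> are nondecreasing in \<open>y\<close>, hence bounded on the unit interval by
  their values \<open>Lp p - 1\<close> and \<open>pi / 2 - Lp p\<close> at \<open>1\<close>. This gives explicit uniform
  distances from the profile to the tent function (\<open>profile_near_tent\<close>) and to the sine
  (\<open>profile_near_sin\<close>). By dominated convergence \<open>Lp p\<close> tends to \<open>1\<close> as \<open>p \<rightarrow> \<infinity>\<close> and to
  \<open>pi / 2\<close> as \<open>p\<close> decreases to \<open>1\<close>; in the first case the amplitude also tends to \<open>1\<close>.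
\<close>

section \<open>The inverse generalized sine\<close>

definition gen_arcsin :: "real \<Rightarrow> real \<Rightarrow> real" where
  "gen_arcsin p y = integral {0..y} (\<lambda>s. 1 / sqrt (1 - s powr (p + 1)))"

lemma gen_arcsin_0 [simp]: "gen_arcsin p 0 = 0"
  by (simp add: gen_arcsin_def)

lemma gen_arcsin_1: "gen_arcsin p 1 = Lp p"
  by (simp add: gen_arcsin_def Lp_def)

text \<open>The improper integral converges because \<open>arcsin\<close> is continuous up to \<open>1\<close>. For every \<open>p \<ge> 1\<close>
this integrand is the majorant behind integrability and dominated convergence.\<close>

lemma arcsin_integrand_has_integral:
  "((\<lambda>s::real. 1 / sqrt (1 - s\<^sup>2)) has_integral (pi / 2)) {0..1}"
proof -
  have "((\<lambda>s::real. 1 / sqrt (1 - s\<^sup>2)) has_integral (arcsin 1 - arcsin 0)) {0..1}"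
  proof (rule fundamental_theorem_of_calculus_interior)
    show "continuous_on {0..1} arcsin"
      by (rule continuous_on_subset[OF continuous_on_arcsin']) auto
    show "(arcsin has_vector_derivative 1 / sqrt (1 - x\<^sup>2)) (at x)" if "x \<in> {0<..<1}" for x :: real
      using that DERIV_arcsin[of x]
      by (simp add: has_real_derivative_iff_has_vector_derivative [symmetric] inverse_eq_divide)
  qed simp
  then show ?thesis by simp
qed

lemma gen_integrand_le_arcsin_integrand:
  assumes "p \<ge> 1" "0 \<le> s" "s \<le> 1"
  shows "1 / sqrt (1 - s powr (p + 1)) \<le> 1 / sqrt (1 - s\<^sup>2)"
proof (cases "s = 1")
  case False
  have "s powr (p + 1) \<le> s powr 2"
    using assms by (intro powr_mono') auto
  also have "\<dots> = s\<^sup>2"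
    using assms by simp
  finally have "s powr (p + 1) \<le> s\<^sup>2" .
  moreover have "s\<^sup>2 < 1"
    using assms False by (simp add: power_less_one_iff abs_square_less_1)
  ultimately show ?thesis
    by (intro divide_left_mono) auto
qed simp

lemma powr_less_one_iff_unit:
  assumes "q > 0" "0 \<le> s"
  shows "s powr q < 1 \<longleftrightarrow> s < (1::real)"
proof
  assume "s powr q < 1"
  then show "s < 1"
    using ge_one_powr_ge_zero[of s q] assms by (meson leD leI less_imp_le)
next
  assume "s < 1"
  then show "s powr q < 1"
    using powr_less_mono2[of q s 1] assms by simp
qed

lemma one_le_gen_integrand:
  assumes "p \<ge> 1" "0 \<le> s" "s < 1"
  shows "1 \<le> 1 / sqrt (1 - s powr (p + 1))"
  using powr_less_one_iff_unit[of "p+1" s] assms by (simp add: divide_simps)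

lemma gen_integrand_integrable:
  assumes "p \<ge> 1"
  shows "(\<lambda>s. 1 / sqrt (1 - s powr (p + 1))) integrable_on {0..1}"
proof (rule measurable_bounded_by_integrable_imp_integrable_real)
  have "(\<lambda>s. 1 / sqrt (1 - s powr (p + 1))) \<in> borel_measurable borel"
    by measurable
  then show "(\<lambda>s. 1 / sqrt (1 - s powr (p + 1))) \<in> borel_measurable (lebesgue_on {0..1})"
    by (simp add: borel_measurable_if_D measurable_completion measurable_restrict_space1)
  show "(\<lambda>s::real. 1 / sqrt (1 - s\<^sup>2)) integrable_on {0..1}"
    using arcsin_integrand_has_integral by blast
  show "\<bar>1 / sqrt (1 - s powr (p + 1))\<bar> \<le> 1 / sqrt (1 - s\<^sup>2)" if "s \<in> {0..1}" for s
  proof -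
    have "s powr (p + 1) \<le> 1"
      using that assms by (intro powr_le1) auto
    then show ?thesis
      using gen_integrand_le_arcsin_integrand[of p s] that assms by simp
  qed
qed simp

lemma continuous_on_gen_arcsin:
  assumes "p \<ge> 1"
  shows "continuous_on {0..1} (gen_arcsin p)"
  unfolding gen_arcsin_def
  by (rule indefinite_integral_continuous_1[OF gen_integrand_integrable[OF assms]])

lemma DERIV_gen_arcsin:
  assumes "p \<ge> 1" "0 < y" "y < 1"
  shows "(gen_arcsin p has_real_derivative 1 / sqrt (1 - y powr (p + 1))) (at y)"
proof -
  define c where "c = (y + 1) / 2"
  have c: "y < c" "c < 1" using assms by (auto simp: c_def)
  have "continuous_on {0..c} (\<lambda>s. s powr (p + 1))"
    by (rule continuous_on_powr') (use assms in \<open>auto intro!: continuous_intros\<close>)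
  moreover have "sqrt (1 - s powr (p + 1)) \<noteq> 0" if "s \<in> {0..c}" for s
    using that powr_less_one_iff_unit[of "p+1" s] assms c by auto
  ultimately have "continuous_on {0..c} (\<lambda>s. 1 / sqrt (1 - s powr (p + 1)))"
    by (intro continuous_on_divide continuous_on_real_sqrt continuous_on_diff continuous_on_const) auto
  from integral_has_real_derivative[OF this, of y]
  have "(gen_arcsin p has_real_derivative 1 / sqrt (1 - y powr (p + 1))) (at y within {0..c})"
    using assms c unfolding gen_arcsin_def [abs_def] by simp
  moreover have "at y within {0..c} = at y"
    using assms c by (intro at_within_interior) auto
  ultimately show ?thesis by simp
qed

text \<open>The two inequalities say that \<open>gen_arcsin p y - y\<close> and \<open>arcsin y - gen_arcsin p y\<close> are
nondecreasing, which follows from the order of the three derivatives in the interior. Stating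
them for increments makes both endpoints available: increments from \<open>0\<close> give the sign of the
differences and increments up to \<open>1\<close> give their uniform bounds in terms of \<open>Lp p\<close>.\<close>

lemma gen_arcsin_diff_bounds:
  assumes p: "p \<ge> 1" and "0 \<le> x" "x \<le> y" "y \<le> 1"
  shows "y - x \<le> gen_arcsin p y - gen_arcsin p x"
    and "gen_arcsin p y - gen_arcsin p x \<le> arcsin y - arcsin x"
proof -
  have c: "continuous_on {x..y} (gen_arcsin p)"
    by (rule continuous_on_subset[OF continuous_on_gen_arcsin[OF p]]) (use assms in auto)
  have ca: "continuous_on {x..y} arcsin"
    by (rule continuous_on_subset[OF continuous_on_arcsin']) (use assms in auto)
  have "gen_arcsin p x - x \<le> gen_arcsin p y - y"
  proof (rule DERIV_nonneg_imp_increasing_open[OF \<open>x \<le> y\<close>])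
    fix s assume s: "x < s" "s < y"
    have "((\<lambda>s. gen_arcsin p s - s) has_real_derivative 1 / sqrt (1 - s powr (p + 1)) - 1) (at s)"
      using s assms by (intro derivative_intros DERIV_gen_arcsin) auto
    moreover have "1 / sqrt (1 - s powr (p + 1)) - 1 \<ge> 0"
      using one_le_gen_integrand[of p s] s assms by simp
    ultimately show "\<exists>d. ((\<lambda>s. gen_arcsin p s - s) has_real_derivative d) (at s) \<and> 0 \<le> d"
      by blast
  qed (intro continuous_intros c)
  then show "y - x \<le> gen_arcsin p y - gen_arcsin p x" by simp
  have "arcsin x - gen_arcsin p x \<le> arcsin y - gen_arcsin p y"
  proof (rule DERIV_nonneg_imp_increasing_open[OF \<open>x \<le> y\<close>])
    fix s assume s: "x < s" "s < y"
    have "((\<lambda>s. arcsin s - gen_arcsin p s) has_real_derivative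
             inverse (sqrt (1 - s\<^sup>2)) - 1 / sqrt (1 - s powr (p + 1))) (at s)"
      using s assms by (intro derivative_intros DERIV_gen_arcsin DERIV_arcsin) auto
    moreover have "inverse (sqrt (1 - s\<^sup>2)) - 1 / sqrt (1 - s powr (p + 1)) \<ge> 0"
      using gen_integrand_le_arcsin_integrand[of p s] s assms by (simp add: inverse_eq_divide)
    ultimately show "\<exists>d. ((\<lambda>s. arcsin s - gen_arcsin p s) has_real_derivative d) (at s) \<and> 0 \<le> d"
      by blast
  qed (intro continuous_intros c ca)
  then show "gen_arcsin p y - gen_arcsin p x \<le> arcsin y - arcsin x" by simp
qed

lemma Lp_bounds:
  assumes "p \<ge> 1"
  shows "1 \<le> Lp p" "Lp p \<le> pi / 2"
  using gen_arcsin_diff_bounds[of p 0 1] assms by (auto simp: gen_arcsin_1)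

lemma strict_mono_on_gen_arcsin:
  assumes "p \<ge> 1"
  shows "strict_mono_on {0..1} (gen_arcsin p)"
proof (rule strict_mono_onI)
  fix x y :: real assume "x \<in> {0..1}" "y \<in> {0..1}" "x < y"
  then show "gen_arcsin p x < gen_arcsin p y"
    using gen_arcsin_diff_bounds(1)[of p x y] assms by auto
qed

lemma bij_betw_gen_arcsin:
  assumes p: "p \<ge> 1"
  shows "bij_betw (gen_arcsin p) {0..1} {0..Lp p}"
proof (rule bij_betw_imageI)
  show "inj_on (gen_arcsin p) {0..1}"
    using strict_mono_on_gen_arcsin[OF p] by (rule strict_mono_on_imp_inj_on)
  show "gen_arcsin p ` {0..1} = {0..Lp p}"
  proof
    show "gen_arcsin p ` {0..1} \<subseteq> {0..Lp p}"
    proof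
      fix z assume "z \<in> gen_arcsin p ` {0..1}"
      then obtain y where "y \<in> {0..1}" "z = gen_arcsin p y" by blast
      then show "z \<in> {0..Lp p}"
        using gen_arcsin_diff_bounds(1)[of p 0 y] gen_arcsin_diff_bounds(1)[of p y 1] p
        by (auto simp: gen_arcsin_1)
    qed
    show "{0..Lp p} \<subseteq> gen_arcsin p ` {0..1}"
    proof
      fix z assume "z \<in> {0..Lp p}"
      then obtain y where "0 \<le> y" "y \<le> 1" "gen_arcsin p y = z"
        using IVT'[of "gen_arcsin p" 0 z 1] continuous_on_gen_arcsin[OF p]
        by (auto simp: gen_arcsin_1)
      then show "z \<in> gen_arcsin p ` {0..1}" by auto
    qed
  qed
qed

text \<open>Both limits of \<open>Lp\<close> are instances with different pointwise limits \<open>g\<close> of the integrands.\<close>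

lemma gen_integrand_dominated_convergence:
  fixes P :: "nat \<Rightarrow> real"
  assumes "\<And>n. P n \<ge> 1"
    and "\<And>s. 0 \<le> s \<Longrightarrow> s < 1 \<Longrightarrow> (\<lambda>n. 1 / sqrt (1 - s powr (P n + 1))) \<longlonglongrightarrow> g s"
    and "(g has_integral I) {0..1}"
  shows "(\<lambda>n. Lp (P n)) \<longlonglongrightarrow> I"
proof -
  \<comment> \<open>At \<open>s = 1\<close> every integrand is \<open>1 / 0 = 0\<close>, so the pointwise limit on all of \<open>[0, 1]\<close> is \<open>?g\<close>.\<close>
  let ?g = "\<lambda>s. if s = 1 then 0 else g s"
  have "(\<lambda>n. integral {0..1} (\<lambda>s. 1 / sqrt (1 - s powr (P n + 1)))) \<longlonglongrightarrow> integral {0..1} ?g"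
  proof (rule dominated_convergence)
    show "(\<lambda>s. 1 / sqrt (1 - s powr (P n + 1))) integrable_on {0..1}" for n
      by (rule gen_integrand_integrable) fact
    show "(\<lambda>s::real. 1 / sqrt (1 - s\<^sup>2)) integrable_on {0..1}"
      using arcsin_integrand_has_integral by blast
    show "norm (1 / sqrt (1 - s powr (P n + 1))) \<le> 1 / sqrt (1 - s\<^sup>2)" if "s \<in> {0..1}" for n s
    proof -
      have "s powr (P n + 1) \<le> 1"
        using that assms(1)[of n] by (intro powr_le1) auto
      then show ?thesis
        using gen_integrand_le_arcsin_integrand[of "P n" s] that assms(1)[of n] by simp
    qed
    show "(\<lambda>n. 1 / sqrt (1 - s powr (P n + 1))) \<longlonglongrightarrow> ?g s" if "s \<in> {0..1}" for s
      using assms(2)[of s] that by auto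
  qed
  moreover have "(?g has_integral I) {0..1}"
    by (rule has_integral_spike[OF _ _ assms(3), of "{1}"]) auto
  ultimately show ?thesis
    by (simp add: Lp_def integral_unique)
qed

lemma Lp_tendsto_1: "(Lp \<longlongrightarrow> 1) at_top"
proof (rule tendsto_at_topI_sequentially)
  fix X :: "nat \<Rightarrow> real" assume X: "filterlim X at_top sequentially"
  \<comment> \<open>Truncating at \<open>1\<close> makes the domination hold for all indices and changes only finitely many.\<close>
  have m: "filterlim (\<lambda>n. max (X n) 1) at_top sequentially"
    by (rule filterlim_at_top_mono[OF X]) auto
  have "(\<lambda>n. Lp (max (X n) 1)) \<longlonglongrightarrow> 1"
  proof (rule gen_integrand_dominated_convergence)
    fix s :: real assume s: "0 \<le> s" "s < 1"
    have "((\<lambda>q. s powr (q + 1)) \<longlongrightarrow> 0) at_top"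
    proof (cases "s = 0")
      case False
      with s show ?thesis by real_asymp
    qed simp
    then have "((\<lambda>q. 1 / sqrt (1 - s powr (q + 1))) \<longlongrightarrow> 1 / sqrt (1 - 0)) at_top"
      by (intro tendsto_intros) auto
    from filterlim_compose[OF this m]
    show "(\<lambda>n. 1 / sqrt (1 - s powr (max (X n) 1 + 1))) \<longlonglongrightarrow> 1" by simp
  next
    show "((\<lambda>s. 1 :: real) has_integral 1) {0..1::real}"
      using has_integral_const_real[of "1::real" 0 1] by simp
  qed simp
  moreover have "\<forall>\<^sub>F n in sequentially. Lp (max (X n) 1) = Lp (X n)"
    using X by (auto simp: filterlim_at_top max_def elim!: allE[of _ 1] eventually_mono)
  ultimately show "(\<lambda>n. Lp (X n)) \<longlonglongrightarrow> 1"
    by (rule Lim_transform_eventually)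
qed

lemma Lp_tendsto_pi_half: "(Lp \<longlongrightarrow> pi / 2) (at_right 1)"
  unfolding tendsto_at_iff_sequentially comp_def
proof (intro allI impI)
  fix X :: "nat \<Rightarrow> real" assume X: "\<forall>i. X i \<in> {1<..} - {1}" "X \<longlonglongrightarrow> 1"
  show "(\<lambda>n. Lp (X n)) \<longlonglongrightarrow> pi / 2"
  proof (rule gen_integrand_dominated_convergence[OF _ _ arcsin_integrand_has_integral])
    fix s :: real assume s: "0 \<le> s" "s < 1"
    have "(\<lambda>n. s powr (X n + 1)) \<longlonglongrightarrow> s\<^sup>2"
    proof (cases "s = 0")
      case False
      then have "(\<lambda>n. s powr (X n + 1)) \<longlonglongrightarrow> s powr (1 + 1)"
        by (intro tendsto_intros X) auto
      then show ?thesis using s by simp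
    qed simp
    moreover have "s\<^sup>2 < 1"
      using s by (simp add: abs_square_less_1)
    ultimately show "(\<lambda>n. 1 / sqrt (1 - s powr (X n + 1))) \<longlonglongrightarrow> 1 / sqrt (1 - s\<^sup>2)"
      by (intro tendsto_intros) auto
  qed (use X in \<open>auto intro: less_imp_le\<close>)
qed

section \<open>The normalized profile\<close>

text \<open>Since \<open>g\<close> is continuous, \<open>f\<close> differs by a constant from an antiderivative of \<open>g\<close>: the
fundamental theorem of calculus tolerates the exceptional point \<open>c\<close>. It is used to glue the two
halves of the profile at their common maximum.\<close>

lemma DERIV_at_removable_point:
  fixes f g :: "real \<Rightarrow> real"
  assumes x: "a < x" "x < b"
    and f: "continuous_on {a<..<b} f" and g: "continuous_on {a<..<b} g"
    and deriv: "\<And>y. a < y \<Longrightarrow> y < b \<Longrightarrow> y \<noteq> c \<Longrightarrow> (f has_real_derivative g y) (at y)"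
  shows "(f has_real_derivative g x) (at x)"
proof -
  define l where "l = (a + x) / 2"
  define r where "r = (x + b) / 2"
  have lr: "a < l" "l < x" "x < r" "r < b" using x by (auto simp: l_def r_def)
  have gc: "continuous_on {l..r} g"
    by (rule continuous_on_subset[OF g]) (use lr in auto)
  have ftc: "f y = f l + integral {l..y} g" if "y \<in> {l..r}" for y
  proof -
    have "(g has_integral (f y - f l)) {l..y}"
    proof (rule fundamental_theorem_of_calculus_strong[of "{c}"])
      show "continuous_on {l..y} f"
        by (rule continuous_on_subset[OF f]) (use lr that in auto)
      show "(f has_vector_derivative g z) (at z)" if "z \<in> {l..y} - {c}" for z
        using deriv[of z] that \<open>y \<in> {l..r}\<close> lr
        by (auto simp: has_real_derivative_iff_has_vector_derivative [symmetric])
    qed (use that in auto)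
    then show ?thesis by (simp add: integral_unique)
  qed
  have d: "((\<lambda>y. f l + integral {l..y} g) has_derivative (*) (g x)) (at x within {l..r})"
    using DERIV_add[OF DERIV_const integral_has_real_derivative[OF gc, of x]] lr
    by (simp add: has_field_derivative_def)
  have "(f has_derivative (*) (g x)) (at x within {l..r})"
  proof (rule has_derivative_transform[OF _ _ d])
    show "f y = f l + integral {l..y} g" if "y \<in> {l..r}" for y
      using that by (rule ftc)
  qed (use lr in simp)
  then have "(f has_real_derivative g x) (at x within {l..r})"
    unfolding has_field_derivative_def .
  moreover have "at x within {l..r} = at x"
    using lr by (intro at_within_interior) auto
  ultimately show ?thesis by simp
qed

text \<open>The argument \<open>2 * Lp p * min t (1 - t)\<close> runs through \<open>[0, Lp p]\<close> on each half of the unit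
interval, which performs the reflection at \<open>1/2\<close>. Outside the unit interval the value is
arbitrary.\<close>

definition profile :: "real \<Rightarrow> real \<Rightarrow> real" where
  "profile p t = inv_into {0..1} (gen_arcsin p) (2 * Lp p * min t (1 - t))"

definition profile_deriv :: "real \<Rightarrow> real \<Rightarrow> real" where
  "profile_deriv p t =
     (if t \<le> 1/2 then 1 else - 1) * (2 * Lp p * sqrt (1 - profile p t powr (p + 1)))"

lemma two_min_le_one: "2 * min t (1 - t) \<le> (1::real)"
  by (simp add: min_def)

lemma profile_reflect: "profile p (1 - t) = profile p t"
  by (simp add: profile_def min.commute)

lemma profile_arg_in_range:
  assumes "p \<ge> 1" "t \<in> {0..1}"
  shows "2 * Lp p * min t (1 - t) \<in> {0..Lp p}"
proof -
  have "Lp p * (2 * min t (1 - t)) \<le> Lp p * 1"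
    using assms Lp_bounds(1)[of p] by (intro mult_left_mono two_min_le_one) auto
  then show ?thesis
    using assms Lp_bounds[of p] by (auto simp: mult_ac)
qed

lemma profile_in_unit:
  assumes "p \<ge> 1" "t \<in> {0..1}"
  shows "profile p t \<in> {0..1}"
  using inv_into_into[of "2 * Lp p * min t (1 - t)" "gen_arcsin p" "{0..1}"]
    profile_arg_in_range[OF assms] bij_betw_gen_arcsin[OF assms(1)]
  unfolding profile_def bij_betw_def by auto

lemma gen_arcsin_profile:
  assumes "p \<ge> 1" "t \<in> {0..1}"
  shows "gen_arcsin p (profile p t) = 2 * Lp p * min t (1 - t)"
  using f_inv_into_f[of "2 * Lp p * min t (1 - t)" "gen_arcsin p" "{0..1}"]
    profile_arg_in_range[OF assms] bij_betw_gen_arcsin[OF assms(1)]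
  unfolding profile_def bij_betw_def by auto

lemma profile_unique:
  assumes "p \<ge> 1" "y \<in> {0..1}" "gen_arcsin p y = 2 * Lp p * min t (1 - t)"
  shows "profile p t = y"
  using bij_betw_gen_arcsin[OF assms(1)] assms(2)
  unfolding profile_def assms(3)[symmetric] bij_betw_def by (simp add: inv_into_f_f)

lemma profile_boundary:
  assumes "p \<ge> 1"
  shows "profile p 0 = 0" "profile p 1 = 0" "profile p (1/2) = 1"
  using assms by (auto intro!: profile_unique simp: gen_arcsin_1)

lemma profile_pos:
  assumes "p \<ge> 1" "0 < t" "t < 1"
  shows "0 < profile p t"
proof -
  have "gen_arcsin p (profile p t) > 0"
    using gen_arcsin_profile[of p t] Lp_bounds(1)[of p] assms by simp
  then have "profile p t \<noteq> 0" by auto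
  then show ?thesis using profile_in_unit[of p t] assms by auto
qed

lemma profile_less_one:
  assumes "p \<ge> 1" "t \<in> {0..1}" "t \<noteq> 1/2"
  shows "profile p t < 1"
proof -
  have "profile p t \<noteq> 1"
  proof
    assume "profile p t = 1"
    then have "Lp p * (2 * min t (1 - t)) = Lp p * 1"
      using gen_arcsin_profile[of p t] assms by (simp add: gen_arcsin_1 mult_ac)
    then have "2 * min t (1 - t) = 1"
      by (rule mult_left_cancel[THEN iffD1, rotated]) (use Lp_bounds(1)[OF assms(1)] in linarith)
    then have "t = 1/2" by (cases "t \<le> 1 - t") (auto simp: min_def)
    then show False using assms(3) by simp
  qed
  then show ?thesis using profile_in_unit[of p t] assms by auto
qed

lemma continuous_on_profile:
  assumes p: "p \<ge> 1"
  shows "continuous_on {0..1} (profile p)"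
proof -
  have "continuous_on (gen_arcsin p ` {0..1}) (inv_into {0..1} (gen_arcsin p))"
    using bij_betw_gen_arcsin[OF p]
    by (intro continuous_on_inv continuous_on_gen_arcsin[OF p])
       (auto simp: bij_betw_def inv_into_f_f)
  then have "continuous_on {0..Lp p} (inv_into {0..1} (gen_arcsin p))"
    using bij_betw_gen_arcsin[OF p] by (simp add: bij_betw_def)
  moreover have "continuous_on {0..1} (\<lambda>t. 2 * Lp p * min t (1 - t))"
    by (intro continuous_on_mult_left continuous_on_min continuous_on_diff
          continuous_on_const continuous_on_id)
  ultimately show ?thesis
    unfolding profile_def [abs_def]
    by (rule continuous_on_compose2) (use profile_arg_in_range[OF p] in blast)
qed

lemma DERIV_profile_left:
  assumes p: "p \<ge> 1" and t: "0 < t" "t < 1/2"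
  shows "(profile p has_real_derivative 2 * Lp p * sqrt (1 - profile p t powr (p + 1))) (at t)"
proof -
  have L: "Lp p > 0" using Lp_bounds(1)[OF p] by simp
  have y: "0 < profile p t" "profile p t < 1"
    using profile_pos[of p t] profile_less_one[of p t] assms by auto
  have pw: "profile p t powr (p + 1) < 1"
    using powr_less_one_iff_unit[of "p+1" "profile p t"] y p by simp
  have "(profile p has_real_derivative
           inverse (1 / sqrt (1 - profile p t powr (p + 1)) / (2 * Lp p))) (at t)"
  proof (rule DERIV_inverse_function[where f = "\<lambda>y. gen_arcsin p y / (2 * Lp p)" and a = 0 and b = "1/2"])
    show "((\<lambda>y. gen_arcsin p y / (2 * Lp p)) has_real_derivative
            1 / sqrt (1 - profile p t powr (p + 1)) / (2 * Lp p)) (at (profile p t))"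
      by (intro DERIV_cdivide DERIV_gen_arcsin p y)
    show "gen_arcsin p (profile p s) / (2 * Lp p) = s" if "0 < s" "s < 1/2" for s
      using gen_arcsin_profile[of p s] that p L by simp
    show "isCont (profile p) t"
      by (rule continuous_on_interior[OF continuous_on_profile[OF p]]) (use t in auto)
  qed (use pw L t in auto)
  then show ?thesis using L by (simp add: field_simps)
qed

lemma DERIV_profile_right:
  assumes p: "p \<ge> 1" and t: "1/2 < t" "t < 1"
  shows "(profile p has_real_derivative - (2 * Lp p * sqrt (1 - profile p t powr (p + 1)))) (at t)"
proof -
  have "(profile p has_real_derivative 2 * Lp p * sqrt (1 - profile p (1 - t) powr (p + 1))) (at (1 - t))"
    by (rule DERIV_profile_left) (use assms in auto)
  moreover have "((\<lambda>s. 1 - s) has_real_derivative - 1) (at t)"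
    by (auto intro!: derivative_eq_intros)
  ultimately have "((\<lambda>s. profile p (1 - s)) has_real_derivative
      2 * Lp p * sqrt (1 - profile p (1 - t) powr (p + 1)) * - 1) (at t)"
    by (rule DERIV_chain2)
  then show ?thesis by (simp add: profile_reflect)
qed

lemma continuous_on_profile_powr:
  assumes "p \<ge> 1" "q > 0"
  shows "continuous_on {0..1} (\<lambda>t. profile p t powr q)"
proof (rule continuous_on_powr')
  show "continuous_on {0..1} (profile p)"
    by (rule continuous_on_profile) fact
  show "\<forall>t\<in>{0..1}. 0 \<le> profile p t \<and> (profile p t = 0 \<longrightarrow> 0 < q)"
    using profile_in_unit[OF assms(1)] assms(2) by auto
qed (rule continuous_on_const)

lemma continuous_on_profile_deriv:
  assumes p: "p \<ge> 1"
  shows "continuous_on {0..1} (profile_deriv p)"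
proof -
  let ?h = "\<lambda>t. 2 * Lp p * sqrt (1 - profile p t powr (p + 1))"
  have h: "continuous_on {0..1} ?h"
    by (intro continuous_intros continuous_on_profile_powr) (use p in auto)
  have "continuous_on ({0..1/2} \<union> {1/2..1}) (\<lambda>t. if t \<le> 1/2 then ?h t else - ?h t)"
  proof (rule continuous_on_cases)
    show "continuous_on {0..1/2} ?h" "continuous_on {1/2..1} (\<lambda>t. - ?h t)"
      by (auto intro!: continuous_on_minus continuous_on_subset[OF h])
    have half: "?h (1/2) = 0" using profile_boundary[OF p] by simp
    show "\<forall>t. t \<in> {0..1/2} \<and> \<not> t \<le> 1/2 \<or> t \<in> {1/2..1} \<and> t \<le> 1/2 \<longrightarrow> ?h t = - ?h t"
    proof (intro allI impI)
      fix t :: real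
      assume "t \<in> {0..1/2} \<and> \<not> t \<le> 1/2 \<or> t \<in> {1/2..1} \<and> t \<le> 1/2"
      then have t: "t = 1/2" by auto
      show "?h t = - ?h t" unfolding t half by simp
    qed
  qed auto
  moreover have un: "{0..1/2} \<union> {1/2..1} = {0..1::real}" by auto
  moreover have eq: "(\<lambda>t. if t \<le> 1/2 then ?h t else - ?h t) = profile_deriv p"
    by (auto simp: profile_deriv_def)
  ultimately show ?thesis unfolding un eq by blast
qed

lemma DERIV_profile:
  assumes p: "p \<ge> 1" and t: "0 < t" "t < 1"
  shows "(profile p has_real_derivative profile_deriv p t) (at t)"
proof (rule DERIV_at_removable_point[OF t])
  show "continuous_on {0<..<1} (profile p)"
    by (rule continuous_on_subset[OF continuous_on_profile[OF p]]) auto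
  show "continuous_on {0<..<1} (profile_deriv p)"
    by (rule continuous_on_subset[OF continuous_on_profile_deriv[OF p]]) auto
  show "(profile p has_real_derivative profile_deriv p s) (at s)"
    if "0 < s" "s < 1" "s \<noteq> 1/2" for s
    using that DERIV_profile_left[OF p, of s] DERIV_profile_right[OF p, of s]
    by (cases "s < 1/2") (auto simp: profile_deriv_def)
qed

text \<open>The square root in \<open>profile_deriv\<close> is not differentiable at its zero, so the chain rule works
only away from \<open>t = 1/2\<close>. There the factor \<open>1 / sqrt (1 - profile p t powr (p + 1))\<close> cancels
against the derivative of the profile, and what remains extends continuously to \<open>t = 1/2\<close>.\<close>

lemma DERIV_profile_deriv:
  assumes p: "p \<ge> 1" and t: "0 < t" "t < 1"
  shows "(profile_deriv p has_real_derivative - (2 * (p + 1) * (Lp p)\<^sup>2 * profile p t powr p)) (at t)"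
proof (rule DERIV_at_removable_point[OF t])
  show "continuous_on {0<..<1} (profile_deriv p)"
    by (rule continuous_on_subset[OF continuous_on_profile_deriv[OF p]]) auto
  have "continuous_on {0..1} (\<lambda>t. - (2 * (p + 1) * (Lp p)\<^sup>2 * profile p t powr p))"
    by (intro continuous_on_minus continuous_on_mult_left continuous_on_profile_powr) (use p in auto)
  then show "continuous_on {0<..<1} (\<lambda>t. - (2 * (p + 1) * (Lp p)\<^sup>2 * profile p t powr p))"
    by (rule continuous_on_subset) auto
  show "(profile_deriv p has_real_derivative - (2 * (p + 1) * (Lp p)\<^sup>2 * profile p s powr p)) (at s)"
    if s: "0 < s" "s < 1" "s \<noteq> 1/2" for s
  proof -
    let ?y = "profile p s"
    \<comment> \<open>The sign in \<open>profile_deriv\<close> is constant near \<open>s\<close>; only \<open>e * e = 1\<close> enters the result.\<close>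
    define e :: real where "e = (if s < 1/2 then 1 else - 1)"
    have y: "0 < ?y" "?y < 1"
      using profile_pos[of p s] profile_less_one[of p s] p s by auto
    have pw: "?y powr (p + 1) < 1"
      using powr_less_one_iff_unit[of "p+1" ?y] y p by simp
    define d where "d = sqrt (1 - ?y powr (p + 1))"
    have d: "d > 0" using pw by (simp add: d_def)
    have e: "e * e = 1" by (simp add: e_def)
    have D: "profile_deriv p s = e * (2 * Lp p * d)"
      using s by (auto simp: profile_deriv_def e_def d_def)
    have "((\<lambda>t. profile p t powr (p + 1)) has_real_derivative
            (p + 1) * ?y powr (p + 1 - 1) * profile_deriv p s) (at s)"
      by (rule DERIV_chain2[OF has_real_derivative_powr DERIV_profile]) (use y p s in auto)
    then have "((\<lambda>t. 1 - profile p t powr (p + 1)) has_real_derivative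
            0 - (p + 1) * ?y powr (p + 1 - 1) * profile_deriv p s) (at s)"
      by (intro DERIV_diff DERIV_const)
    moreover have "(sqrt has_real_derivative inverse d / 2) (at (1 - ?y powr (p + 1)))"
      unfolding d_def by (rule DERIV_real_sqrt) (use pw in simp)
    ultimately have "((\<lambda>t. sqrt (1 - profile p t powr (p + 1))) has_real_derivative
            inverse d / 2 * (0 - (p + 1) * ?y powr (p + 1 - 1) * profile_deriv p s)) (at s)"
      by (rule DERIV_chain2[rotated])
    then have "((\<lambda>t. e * (2 * Lp p * sqrt (1 - profile p t powr (p + 1)))) has_real_derivative
            e * (2 * Lp p * (inverse d / 2 * (0 - (p + 1) * ?y powr (p + 1 - 1) * profile_deriv p s)))) (at s)"
      by (intro DERIV_cmult)
    moreover have eq: "e * (2 * Lp p * (inverse d / 2 * (0 - (p + 1) * ?y powr (p + 1 - 1) * profile_deriv p s)))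
        = - (2 * (p + 1) * (Lp p)\<^sup>2 * ?y powr p * (e * e))"
      unfolding D using d by (simp add: field_simps power2_eq_square)
    ultimately have der: "((\<lambda>t. e * (2 * Lp p * sqrt (1 - profile p t powr (p + 1)))) has_real_derivative
            - (2 * (p + 1) * (Lp p)\<^sup>2 * ?y powr p)) (at s)"
      unfolding eq unfolding e mult_1_right by blast
    have ev: "\<forall>\<^sub>F t in nhds s. e * (2 * Lp p * sqrt (1 - profile p t powr (p + 1))) = profile_deriv p t"
    proof -
      have "\<forall>\<^sub>F t in nhds s. (t < 1/2) = (s < 1/2) \<and> t \<noteq> 1/2"
      proof (cases "s < 1/2")
        case True
        then have "\<forall>\<^sub>F t in nhds s. t \<in> {..<1/2}"
          by (intro eventually_nhds_in_open) auto
        then show ?thesis by eventually_elim (use True in auto)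
      next
        case False
        then have "\<forall>\<^sub>F t in nhds s. t \<in> {1/2<..}"
          using s by (intro eventually_nhds_in_open) auto
        then show ?thesis by eventually_elim (use False in auto)
      qed
      then show ?thesis
        by eventually_elim (auto simp: profile_deriv_def e_def)
    qed
    show ?thesis
      using der unfolding DERIV_cong_ev[OF refl ev refl] .
  qed
qed

text \<open>With \<open>y = profile p t\<close> and \<open>m = min t (1 - t)\<close> one has \<open>gen_arcsin p y = 2 * Lp p * m\<close>, which
exceeds each of \<open>y\<close> and \<open>2 * m\<close> by at most \<open>Lp p - 1\<close>.\<close>

lemma profile_near_tent:
  assumes "p \<ge> 1" "t \<in> {0..1}"
  shows "\<bar>profile p t - 2 * min t (1 - t)\<bar> \<le> 2 * (Lp p - 1)"
proof -
  let ?y = "profile p t"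
  have y: "0 \<le> ?y" "?y \<le> 1" using profile_in_unit[OF assms] by auto
  have "?y \<le> 2 * Lp p * min t (1 - t)" "2 * Lp p * min t (1 - t) - ?y \<le> Lp p - 1"
    using gen_arcsin_diff_bounds(1)[of p 0 ?y] gen_arcsin_diff_bounds(1)[of p ?y 1]
      gen_arcsin_profile[OF assms] assms y by (auto simp: gen_arcsin_1)
  moreover have "0 \<le> (Lp p - 1) * (2 * min t (1 - t))" "(Lp p - 1) * (2 * min t (1 - t)) \<le> (Lp p - 1) * 1"
    using assms Lp_bounds[of p] by (auto intro!: mult_nonneg_nonneg mult_left_mono two_min_le_one simp del: mult_1_right)
  ultimately show ?thesis
    using Lp_bounds(1)[OF assms(1)] unfolding abs_le_iff by (simp add: algebra_simps)
qed

lemma abs_sin_diff_le: "\<bar>sin x - sin y\<bar> \<le> \<bar>x - y\<bar>" for x y :: real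
proof -
  have "sin x - sin y = 2 * (sin ((x - y) / 2) * cos ((x + y) / 2))"
    using sin_diff_sin[of x y] by simp
  also have "\<bar>\<dots>\<bar> \<le> 2 * (\<bar>(x - y) / 2\<bar> * 1)"
    unfolding abs_mult by (intro mult_mono abs_sin_x_le_abs_x mult_nonneg_nonneg) auto
  finally show ?thesis by simp
qed

text \<open>The angle \<open>arcsin (profile p t)\<close> exceeds \<open>2 * Lp p * min t (1 - t)\<close> by at most
\<open>pi / 2 - Lp p\<close>, and so does \<open>pi * min t (1 - t)\<close>. The sine does not increase distances and takes the same
value at \<open>pi * t\<close> and \<open>pi * (1 - t)\<close>.\<close>

lemma profile_near_sin:
  assumes "p \<ge> 1" "t \<in> {0..1}"
  shows "\<bar>profile p t - sin (pi * t)\<bar> \<le> 2 * (pi / 2 - Lp p)"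
proof -
  let ?y = "profile p t" and ?m = "min t (1 - t)"
  have y: "0 \<le> ?y" "?y \<le> 1" using profile_in_unit[OF assms] by auto
  have 1: "0 \<le> arcsin ?y - 2 * Lp p * ?m" "arcsin ?y - 2 * Lp p * ?m \<le> pi / 2 - Lp p"
    using gen_arcsin_diff_bounds(2)[of p 0 ?y] gen_arcsin_diff_bounds(2)[of p ?y 1]
      gen_arcsin_profile[OF assms] assms y by (auto simp: gen_arcsin_1)
  have 2: "0 \<le> (pi / 2 - Lp p) * (2 * ?m)" "(pi / 2 - Lp p) * (2 * ?m) \<le> (pi / 2 - Lp p) * 1"
    using assms Lp_bounds[of p] by (auto intro!: mult_nonneg_nonneg mult_left_mono two_min_le_one simp del: mult_1_right)
  have "\<bar>sin (arcsin ?y) - sin (pi * ?m)\<bar> \<le> \<bar>arcsin ?y - pi * ?m\<bar>"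
    by (rule abs_sin_diff_le)
  also have "\<dots> \<le> 2 * (pi / 2 - Lp p)"
    using 1 2 by (simp add: algebra_simps abs_le_iff)
  finally have "\<bar>sin (arcsin ?y) - sin (pi * ?m)\<bar> \<le> 2 * (pi / 2 - Lp p)" .
  moreover have "sin (pi * ?m) = sin (pi * t)"
    by (simp add: min_def right_diff_distrib sin_diff)
  ultimately show ?thesis using y by simp
qed

section \<open>Classification of the one-dimensional solutions\<close>

text \<open>The energy \<open>w'\<^sup>2 + 2 * lam / (p + 1) * w powr (p + 1)\<close> is constant, and evaluating it at the
critical point \<open>c\<close> identifies the constant. Strict concavity makes \<open>w' > 0\<close> before \<open>c\<close>, so
the positive root can be taken: \<open>w'\<close> is a multiple of \<open>sqrt (1 - (w / w c) powr (p + 1))\<close>, and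
\<open>gen_arcsin p\<close> is exactly the function whose derivative cancels this root.\<close>

lemma gen_arcsin_linear_up_to_max:
  fixes w w' :: "real \<Rightarrow> real"
  assumes p: "p \<ge> 1" and lam: "lam > 0" and c: "c > 0"
    and cont: "continuous_on {0..c} w" and w0: "w 0 = 0"
    and pos: "\<And>t. 0 < t \<Longrightarrow> t \<le> c \<Longrightarrow> w t > 0"
    and d1: "\<And>t. 0 < t \<Longrightarrow> t \<le> c \<Longrightarrow> (w has_real_derivative w' t) (at t)"
    and d2: "\<And>t. 0 < t \<Longrightarrow> t \<le> c \<Longrightarrow> (w' has_real_derivative - (lam * w t powr p)) (at t)"
    and crit: "w' c = 0"
    and t: "0 \<le> t" "t \<le> c"
  shows "gen_arcsin p (w t / w c) = sqrt (2 * lam / (p + 1) * w c powr (p + 1)) / w c * t"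
proof -
  define M where "M = w c"
  define K where "K = 2 * lam / (p + 1) * M powr (p + 1)"
  have M: "M > 0" using pos[of c] c by (simp add: M_def)
  have K: "K > 0" using M lam p by (simp add: K_def)
  have w'_pos: "w' s > 0" if s: "0 < s" "s < c" for s
  proof -
    have "w' c < w' s"
    proof (rule DERIV_neg_imp_decreasing[OF s(2)])
      fix x assume "s \<le> x" "x \<le> c"
      then show "\<exists>y. (w' has_real_derivative y) (at x) \<and> y < 0"
        using d2[of x] pos[of x] s lam by (intro exI[of _ "- (lam * w x powr p)"]) auto
    qed
    then show ?thesis by (simp add: crit)
  qed
  have mono: "w x < w y" if "0 \<le> x" "x < y" "y \<le> c" for x y
  proof (rule DERIV_pos_imp_increasing_open[OF that(2)])
    show "\<exists>D. (w has_real_derivative D) (at s) \<and> 0 < D" if "x < s" "s < y" for s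
      using d1[of s] w'_pos[of s] that \<open>0 \<le> x\<close> \<open>y \<le> c\<close> by (intro exI[of _ "w' s"]) auto
    show "continuous_on {x..y} w"
      by (rule continuous_on_subset[OF cont]) (use that in auto)
  qed
  have le_M: "w s \<le> M" if "0 \<le> s" "s \<le> c" for s
    using mono[of s c] that by (cases "s = c") (auto simp: M_def)
  have nonneg: "0 \<le> w s" if "0 \<le> s" "s \<le> c" for s
    using pos[of s] that w0 by (cases "s = 0") auto
  have energy: "(w' s)\<^sup>2 + 2 * lam / (p + 1) * w s powr (p + 1) = K" if s: "0 < s" "s < c" for s
  proof -
    let ?E = "\<lambda>x. (w' x)\<^sup>2 + 2 * lam / (p + 1) * w x powr (p + 1)"
    have dE: "(?E has_real_derivative 0) (at x)" if x: "0 < x" "x \<le> c" for x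
    proof -
      have "((\<lambda>x. w x powr (p + 1)) has_real_derivative (p + 1) * w x powr (p + 1 - 1) * w' x) (at x)"
        by (rule DERIV_chain2[OF has_real_derivative_powr d1]) (use pos x in auto)
      moreover have "((\<lambda>x. (w' x)\<^sup>2) has_real_derivative
          of_nat 2 * (- (lam * w x powr p) * w' x ^ (2 - Suc 0))) (at x)"
        by (rule DERIV_power[OF d2]) (use x in auto)
      ultimately have "(?E has_real_derivative
          of_nat 2 * (- (lam * w x powr p) * w' x ^ (2 - Suc 0)) +
          2 * lam / (p + 1) * ((p + 1) * w x powr (p + 1 - 1) * w' x)) (at x)"
        by (intro DERIV_add DERIV_cmult)
      moreover have "of_nat 2 * (- (lam * w x powr p) * w' x ^ (2 - Suc 0)) +
          2 * lam / (p + 1) * ((p + 1) * w x powr (p + 1 - 1) * w' x) = 0"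
        using p by (simp add: field_simps)
      ultimately show ?thesis by (simp only:)
    qed
    have "?E c = ?E s"
    proof (rule DERIV_isconst_end[OF s(2)])
      show "continuous_on {s..c} ?E"
        by (rule DERIV_atLeastAtMost_imp_continuous_on, rule exI, rule dE) (use s in auto)
    qed (use dE s in auto)
    then show ?thesis by (simp add: crit K_def M_def)
  qed
  have w'_eq: "w' s = sqrt K * sqrt (1 - (w s / M) powr (p + 1))" if s: "0 < s" "s < c" for s
  proof -
    have "K * (w s / M) powr (p + 1) = 2 * lam / (p + 1) * w s powr (p + 1)"
      using pos[of s] s M by (simp add: K_def powr_divide)
    then have "(w' s)\<^sup>2 = K * (1 - (w s / M) powr (p + 1))"
      using energy[OF s] unfolding right_diff_distrib by linarith
    then have "sqrt ((w' s)\<^sup>2) = sqrt K * sqrt (1 - (w s / M) powr (p + 1))"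
      by (simp add: real_sqrt_mult)
    then show ?thesis using w'_pos[OF s] by simp
  qed
  let ?H = "\<lambda>s. gen_arcsin p (w s / M) - sqrt K / M * s"
  have "?H t = ?H 0"
  proof (rule DERIV_isconst2[OF c _ _ t])
    have "continuous_on {0..c} (\<lambda>s. gen_arcsin p (w s / M))"
    proof (rule continuous_on_compose2[OF continuous_on_gen_arcsin[OF p]])
      show "continuous_on {0..c} (\<lambda>s. w s / M)"
        using M by (intro continuous_on_divide cont continuous_on_const) auto
      show "(\<lambda>s. w s / M) ` {0..c} \<subseteq> {0..1}"
        using le_M nonneg M by auto
    qed
    then show "continuous_on {0..c} ?H"
      by (intro continuous_on_diff continuous_on_mult_left continuous_on_id)
    fix s assume s: "0 < s" "s < c"
    have y: "0 < w s / M" "w s / M < 1"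
      using pos[of s] mono[of s c] s M by (auto simp: M_def)
    have root: "sqrt (1 - (w s / M) powr (p + 1)) > 0"
      using powr_less_one_iff_unit[of "p + 1" "w s / M"] y p by simp
    have "((\<lambda>s. gen_arcsin p (w s / M)) has_real_derivative
        1 / sqrt (1 - (w s / M) powr (p + 1)) * (w' s / M)) (at s)"
      by (rule DERIV_chain2[OF DERIV_gen_arcsin DERIV_cdivide[OF d1]]) (use y s p in auto)
    then have "(?H has_real_derivative
        1 / sqrt (1 - (w s / M) powr (p + 1)) * (w' s / M) - sqrt K / M * 1) (at s)"
      by (intro DERIV_diff DERIV_cmult DERIV_ident)
    moreover have "1 / sqrt (1 - (w s / M) powr (p + 1)) * (w' s / M) - sqrt K / M * 1 = 0"
      unfolding w'_eq[OF s] using root M by (simp add: field_simps)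
    ultimately show "(?H has_real_derivative 0) (at s)" by (simp only:)
  qed
  then show "gen_arcsin p (w t / w c) = sqrt (2 * lam / (p + 1) * w c powr (p + 1)) / w c * t"
    by (simp add: w0 M_def K_def)
qed

text \<open>The previous lemma applies on the left of the maximum point \<open>c\<close> to \<open>w\<close>, and on the right to the
reflection of \<open>w\<close>. The slope \<open>k\<close> depends only on the maximal value, so it is the same on both
sides; matching the values at \<open>c\<close> yields \<open>c = 1/2\<close> and \<open>k = 2 * Lp p\<close>, and the latter equation
determines the maximal value because \<open>p \<noteq> 1\<close>.\<close>

lemma lane_emden_unit_interval:
  fixes w w' :: "real \<Rightarrow> real"
  assumes p: "p > 1" and lam: "lam > 0"
    and cont: "continuous_on {0..1} w" and bd: "w 0 = 0" "w 1 = 0"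
    and pos: "\<And>t. 0 < t \<Longrightarrow> t < 1 \<Longrightarrow> w t > 0"
    and d1: "\<And>t. 0 < t \<Longrightarrow> t < 1 \<Longrightarrow> (w has_real_derivative w' t) (at t)"
    and d2: "\<And>t. 0 < t \<Longrightarrow> t < 1 \<Longrightarrow> (w' has_real_derivative - (lam * w t powr p)) (at t)"
    and t: "t \<in> {0..1}"
  shows "w t = (2 * (p + 1) * (Lp p)\<^sup>2 / lam) powr (1 / (p - 1)) * profile p t"
proof -
  have p1: "p \<ge> 1" using p by simp
  obtain c where c: "c \<in> {0..1}" and max: "\<And>s. s \<in> {0..1} \<Longrightarrow> w s \<le> w c"
    using continuous_attains_sup[OF _ _ cont] by auto
  have "w (1/2) \<le> w c" by (rule max) simp
  then have "w c > 0" using pos[of "1/2"] by simp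
  then have c01: "0 < c" "c < 1" using c bd by (auto simp: less_le)
  have crit: "w' c = 0"
  proof (rule DERIV_local_max[OF d1[OF c01]])
    show "0 < min c (1 - c)" using c01 by simp
    show "\<forall>y. \<bar>c - y\<bar> < min c (1 - c) \<longrightarrow> w y \<le> w c"
      using max by (auto simp: abs_less_iff)
  qed
  define M where "M = w c"
  define k where "k = sqrt (2 * lam / (p + 1) * M powr (p + 1)) / M"
  have M: "M > 0" using \<open>w c > 0\<close> by (simp add: M_def)
  have left: "gen_arcsin p (w s / M) = k * s" if "0 \<le> s" "s \<le> c" for s
    unfolding k_def M_def
  proof (rule gen_arcsin_linear_up_to_max[OF p1 lam c01(1), where w = w and w' = w'])
    show "continuous_on {0..c} w"
      by (rule continuous_on_subset[OF cont]) (use c01 in auto)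
  qed (use pos d1 d2 c01 bd crit that in auto)
  have right: "gen_arcsin p (w s / M) = k * (1 - s)" if "c \<le> s" "s \<le> 1" for s
  proof -
    have "gen_arcsin p (w (1 - (1 - s)) / w (1 - (1 - c))) =
        sqrt (2 * lam / (p + 1) * w (1 - (1 - c)) powr (p + 1)) / w (1 - (1 - c)) * (1 - s)"
    proof (rule gen_arcsin_linear_up_to_max[OF p1 lam, where w = "\<lambda>s. w (1 - s)" and w' = "\<lambda>s. - w' (1 - s)"])
      show "continuous_on {0..1 - c} (\<lambda>s. w (1 - s))"
      proof (rule continuous_on_compose2[OF cont])
        show "continuous_on {0..1 - c} (\<lambda>s. 1 - s)"
          by (intro continuous_intros)
      qed (use c01 in auto)
      have minus: "((\<lambda>s. 1 - s) has_real_derivative - 1) (at x)" for x :: real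
        by (auto intro!: derivative_eq_intros)
      fix x assume x: "0 < x" "x \<le> 1 - c"
      show "((\<lambda>s. w (1 - s)) has_real_derivative - w' (1 - x)) (at x)"
        using DERIV_chain2[OF d1[of "1 - x"] minus] x c01 by simp
      show "((\<lambda>s. - w' (1 - s)) has_real_derivative - (lam * w (1 - x) powr p)) (at x)"
        using DERIV_minus[OF DERIV_chain2[OF d2[of "1 - x"] minus]] x c01 by simp
    qed (use pos c01 crit bd that in auto)
    then show ?thesis by (simp add: k_def M_def)
  qed
  have L: "Lp p \<ge> 1" using Lp_bounds(1)[OF p1] .
  have "k * c = Lp p" "k * (1 - c) = Lp p"
    using left[of c] right[of c] c01 M by (auto simp: gen_arcsin_1 M_def)
  then have "k * c = k * (1 - c)" and k0: "k \<noteq> 0" using L by auto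
  then have chalf: "c = 1/2" by (simp add: mult_cancel_left)
  with \<open>k * c = Lp p\<close> have k: "k = 2 * Lp p" by simp

  have "gen_arcsin p (w t / M) = 2 * Lp p * min t (1 - t)"
    using left[of t] right[of t] t by (cases "t \<le> 1/2") (auto simp: chalf k min_def)
  moreover have "w t / M \<in> {0..1}"
    using max[OF t] pos[of t] bd t M by (cases "t = 0 \<or> t = 1") (auto simp: M_def)
  ultimately have prof: "profile p t = w t / M"
    by (intro profile_unique p1)

  have "sqrt (2 * lam / (p + 1) * M powr (p + 1)) = 2 * Lp p * M"
    using k M by (simp add: k_def field_simps)
  then have "(sqrt (2 * lam / (p + 1) * M powr (p + 1)))\<^sup>2 = (2 * Lp p * M)\<^sup>2"
    by simp
  moreover have "(sqrt (2 * lam / (p + 1) * M powr (p + 1)))\<^sup>2 = 2 * lam / (p + 1) * M powr (p + 1)"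
    by (rule real_sqrt_pow2) (use lam p in simp)
  moreover have "M powr (p + 1) = M powr (p - 1) * M\<^sup>2"
  proof -
    have "M powr (p - 1) * M powr 2 = M powr (p - 1 + 2)"
      by (rule powr_add[symmetric])
    moreover have "p - 1 + 2 = p + 1" by simp
    ultimately show ?thesis using M by simp
  qed
  ultimately have "(2 * lam / (p + 1) * M powr (p - 1)) * M\<^sup>2 = (4 * (Lp p)\<^sup>2) * M\<^sup>2"
    by (simp add: power_mult_distrib)
  then have "2 * lam / (p + 1) * M powr (p - 1) = 4 * (Lp p)\<^sup>2"
    by (rule mult_right_cancel[THEN iffD1, rotated]) (use M in simp)
  then have "M powr (p - 1) = 2 * (p + 1) * (Lp p)\<^sup>2 / lam"
    using lam p by (simp add: field_simps)
  then have "(2 * (p + 1) * (Lp p)\<^sup>2 / lam) powr (1 / (p - 1)) = (M powr (p - 1)) powr (1 / (p - 1))"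
    by simp
  also have "\<dots> = M"
    using M p by (simp add: powr_powr)
  finally show ?thesis using prof M by simp
qed

section \<open>Radial functions on an annulus\<close>

lemma open_annulus: "open (annulus a b)"
  unfolding annulus_def
  by (intro open_Collect_conj open_Collect_less continuous_on_norm_id continuous_on_const)

lemma closure_annulus:
  assumes "0 < a" "a < b"
  shows "closure (annulus a b :: (real^'n::finite) set) = {x. a \<le> norm x \<and> norm x \<le> b}"
proof
  have "closed (norm -` {a..b} :: (real^'n) set)"
    by (intro closed_vimage continuous_on_norm_id) auto
  moreover have "annulus a b \<subseteq> (norm -` {a..b} :: (real^'n) set)"
    by (auto simp: annulus_def)
  ultimately have "closure (annulus a b :: (real^'n) set) \<subseteq> norm -` {a..b}"
    by (intro closure_minimal)
  then show "closure (annulus a b :: (real^'n) set) \<subseteq> {x. a \<le> norm x \<and> norm x \<le> b}"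
    by auto
  show "{x. a \<le> norm x \<and> norm x \<le> b} \<subseteq> closure (annulus a b :: (real^'n) set)"
  proof
    fix x :: "real^'n" assume "x \<in> {x. a \<le> norm x \<and> norm x \<le> b}"
    then have x: "norm x \<in> {a..b}" "x \<noteq> 0" using assms by auto
    let ?ray = "\<lambda>r. (r / norm x) *\<^sub>R x"
    \<comment> \<open>A boundary point is a limit of interior points along its own ray.\<close>
    have "?ray ` closure {a<..<b} \<subseteq> closure (annulus a b)"
    proof (rule image_closure_subset)
      show "continuous_on (closure {a<..<b}) ?ray"
        by (intro continuous_intros) (use x in auto)
      show "?ray ` {a<..<b} \<subseteq> closure (annulus a b)"
        using x assms closure_subset[of "annulus a b :: (real^'n) set"] by (auto simp: annulus_def)
    qed simp
    moreover have "norm x \<in> closure {a<..<b}" using x assms by simp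
    ultimately have "?ray (norm x) \<in> closure (annulus a b)" by (rule subsetD[OF _ imageI])
    then show "x \<in> closure (annulus a b)" using x by simp
  qed
qed

lemma frontier_annulus:
  assumes "0 < a" "a < b"
  shows "frontier (annulus a b :: (real^'n::finite) set) = {x. norm x = a \<or> norm x = b}"
  unfolding frontier_def interior_open[OF open_annulus] closure_annulus[OF assms]
  using assms by (auto simp: annulus_def)

lemma has_partial_derivative_transform:
  fixes u v :: "real^'n::finite \<Rightarrow> real"
  assumes "open S" "x \<in> S" "\<And>z. z \<in> S \<Longrightarrow> u z = v z"
    and "((\<lambda>t. v (x + t *\<^sub>R axis i 1)) has_real_derivative D) (at 0)"
  shows "((\<lambda>t. u (x + t *\<^sub>R axis i 1)) has_real_derivative D) (at 0)"
proof -
  have "open ((\<lambda>t::real. x + t *\<^sub>R axis i 1) -` S)"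
    by (intro open_vimage assms(1) continuous_on_add continuous_on_scaleR
          continuous_on_const continuous_on_id)
  then have "\<forall>\<^sub>F t in nhds (0::real). t \<in> (\<lambda>t. x + t *\<^sub>R axis i 1) -` S"
    by (rule eventually_nhds_in_open) (use assms(2) in simp)
  then have "\<forall>\<^sub>F t in nhds 0. u (x + t *\<^sub>R axis i 1) = v (x + t *\<^sub>R axis i 1)"
    by eventually_elim (use assms(3) in auto)
  from DERIV_cong_ev[OF refl this refl] assms(4) show ?thesis by blast
qed

lemma C1_onI:
  assumes "continuous_on S u"
    and der: "\<And>i x. x \<in> S \<Longrightarrow> ((\<lambda>t. u (x + t *\<^sub>R axis i 1)) has_real_derivative D i x) (at 0)"
    and "\<And>i. continuous_on S (D i)"
  shows "C1_on S u"
proof -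
  have "partial_deriv i u x = D i x" if "x \<in> S" for i x
    unfolding partial_deriv_def by (rule DERIV_imp_deriv[OF der[OF that]])
  then have "continuous_on S (partial_deriv i u)" for i
    using assms(3)[of i] continuous_on_cong[of S S "partial_deriv i u" "D i"] by simp
  then show ?thesis
    unfolding C1_on_def partially_differentiable_def field_differentiable_def
    using assms(1) der by blast
qed

lemma has_partial_derivative_norm:
  fixes x :: "real^'n::finite"
  assumes "x \<noteq> 0"
  shows "((\<lambda>t. norm (x + t *\<^sub>R axis i 1)) has_real_derivative x $ i / norm x) (at 0)"
proof -
  have "((\<lambda>t. x + t *\<^sub>R axis i 1) has_derivative (\<lambda>t. t *\<^sub>R axis i 1)) (at 0)"
    by (auto intro!: derivative_eq_intros)
  moreover have "(norm has_derivative (\<lambda>h. h \<bullet> sgn x)) (at (x + 0 *\<^sub>R axis i 1))"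
    using has_derivative_norm[OF assms] by simp
  ultimately have "((\<lambda>t. norm (x + t *\<^sub>R axis i 1)) has_derivative
      (\<lambda>t. (t *\<^sub>R axis i 1) \<bullet> sgn x)) (at 0)"
    by (rule has_derivative_compose)
  moreover have "(\<lambda>t. (t *\<^sub>R axis i 1) \<bullet> sgn x) = (*) (x $ i / norm x)"
    by (auto simp: inner_axis' sgn_vec_def sgn_div_norm mult.commute field_simps)
  ultimately show ?thesis by (simp add: has_field_derivative_def)
qed

lemma has_partial_derivative_radial:
  fixes x :: "real^'n::finite"
  assumes "x \<noteq> 0" "(f has_real_derivative D) (at (norm x))"
  shows "((\<lambda>t. f (norm (x + t *\<^sub>R axis i 1))) has_real_derivative D * (x $ i / norm x)) (at 0)"
  by (rule DERIV_chain2[OF _ has_partial_derivative_norm[OF assms(1)]]) (use assms(2) in simp)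

lemma has_partial_derivative_coordinate:
  fixes x :: "real^'n::finite"
  shows "((\<lambda>t. (x + t *\<^sub>R axis i 1) $ j) has_real_derivative (if i = j then 1 else 0)) (at 0)"
proof -
  have "((\<lambda>t. x $ j + t * (if i = j then 1 else 0)) has_real_derivative
      0 + 1 * (if i = j then 1 else 0)) (at 0)"
    by (intro DERIV_add DERIV_const DERIV_cmult_right DERIV_ident)
  moreover have "(\<lambda>t. (x + t *\<^sub>R axis i 1) $ j) = (\<lambda>t. x $ j + t * (if i = j then 1 else 0))"
    by (auto simp: axis_def)
  ultimately show ?thesis by simp
qed

context
  fixes a b :: real and u :: "real^'n::finite \<Rightarrow> real" and f f' f'' :: "real \<Rightarrow> real"
  assumes a: "0 < a"
    and radial: "\<And>x. x \<in> annulus a b \<Longrightarrow> u x = f (norm x)"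
    and f': "\<And>r. a < r \<Longrightarrow> r < b \<Longrightarrow> (f has_real_derivative f' r) (at r)"
    and f'': "\<And>r. a < r \<Longrightarrow> r < b \<Longrightarrow> (f' has_real_derivative f'' r) (at r)"
begin

lemma nonzero_annulus: "x \<in> annulus a b \<Longrightarrow> x \<noteq> (0::real^'n)"
  using a by (auto simp: annulus_def)

lemma has_partial_derivative_radial_function:
  assumes x: "x \<in> annulus a b"
  shows "((\<lambda>t. u (x + t *\<^sub>R axis i 1)) has_real_derivative f' (norm x) / norm x * x $ i) (at 0)"
proof (rule has_partial_derivative_transform[OF open_annulus x radial])
  show "((\<lambda>t. f (norm (x + t *\<^sub>R axis i 1))) has_real_derivative f' (norm x) / norm x * x $ i) (at 0)"
    using has_partial_derivative_radial[OF nonzero_annulus[OF x] f', of i] x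
    by (simp add: annulus_def)
qed

lemma partial_deriv_radial:
  "x \<in> annulus a b \<Longrightarrow> partial_deriv i u x = f' (norm x) / norm x * x $ i"
  unfolding partial_deriv_def
  by (rule DERIV_imp_deriv[OF has_partial_derivative_radial_function])

text \<open>On the annulus a first partial derivative is the radial function \<open>f' r / r\<close> times a coordinate,
so the product rule reduces the second derivatives to first derivatives of radial functions.\<close>

lemma has_second_partial_derivative_radial:
  assumes x: "x \<in> annulus a b"
  shows "((\<lambda>t. partial_deriv i u (x + t *\<^sub>R axis j 1)) has_real_derivative
     (f'' (norm x) / norm x - f' (norm x) / (norm x)\<^sup>2) * (x $ j / norm x) * x $ i +
     (if j = i then 1 else 0) * (f' (norm x) / norm x)) (at 0)"
proof (rule has_partial_derivative_transform[OF open_annulus x partial_deriv_radial])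
  have r: "norm x > 0" "a < norm x" "norm x < b"
    using nonzero_annulus[OF x] x by (auto simp: annulus_def)
  have "((\<lambda>r. f' r / r) has_real_derivative
      (f'' (norm x) * norm x - f' (norm x) * 1) / (norm x * norm x)) (at (norm x))"
    by (rule DERIV_divide[OF f'' DERIV_ident]) (use r in auto)
  moreover have "(f'' (norm x) * norm x - f' (norm x) * 1) / (norm x * norm x) =
      f'' (norm x) / norm x - f' (norm x) / (norm x)\<^sup>2"
    using r by (simp add: field_simps power2_eq_square)
  ultimately have "((\<lambda>r. f' r / r) has_real_derivative
      f'' (norm x) / norm x - f' (norm x) / (norm x)\<^sup>2) (at (norm x))"
    by simp
  from DERIV_mult[OF has_partial_derivative_radial[OF nonzero_annulus[OF x] this, of j]
      has_partial_derivative_coordinate[of x j i]]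
  show "((\<lambda>t. f' (norm (x + t *\<^sub>R axis j 1)) / norm (x + t *\<^sub>R axis j 1) * (x + t *\<^sub>R axis j 1) $ i)
     has_real_derivative
     (f'' (norm x) / norm x - f' (norm x) / (norm x)\<^sup>2) * (x $ j / norm x) * x $ i +
     (if j = i then 1 else 0) * (f' (norm x) / norm x)) (at 0)"
    by simp
qed

lemma laplacian_radial:
  assumes x: "x \<in> annulus a b"
  shows "laplacian u x = f'' (norm x) + (real CARD('n) - 1) / norm x * f' (norm x)"
proof -
  let ?r = "norm x" and ?c = "f'' (norm x) / norm x - f' (norm x) / (norm x)\<^sup>2"
  have r: "?r > 0" using nonzero_annulus[OF x] by simp
  have "partial_deriv i (partial_deriv i u) x = ?c * (x $ i / ?r) * x $ i + f' ?r / ?r" for i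
    using DERIV_imp_deriv[OF has_second_partial_derivative_radial[OF x, of i i]]
    by (simp add: partial_deriv_def [of i "partial_deriv i u"])
  then have "laplacian u x = (\<Sum>i\<in>UNIV. ?c * (x $ i / ?r) * x $ i + f' ?r / ?r)"
    by (simp add: laplacian_def)
  also have "\<dots> = (\<Sum>i\<in>UNIV. ?c / ?r * (x $ i)\<^sup>2) + real CARD('n) * (f' ?r / ?r)"
    by (simp add: sum.distrib power2_eq_square mult.assoc)
  also have "(\<Sum>i\<in>UNIV. ?c / ?r * (x $ i)\<^sup>2) = ?c / ?r * (\<Sum>i\<in>UNIV. (x $ i)\<^sup>2)"
    by (rule sum_distrib_left[symmetric])
  also have "(\<Sum>i\<in>UNIV. (x $ i)\<^sup>2) = ?r\<^sup>2"
    by (simp add: norm_vec_def L2_set_def sum_nonneg)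
  finally show ?thesis
    using r by (simp add: field_simps power2_eq_square)
qed

lemma C2_on_radial:
  assumes cont: "continuous_on {a<..<b} f''"
  shows "C2_on (annulus a b) u"
proof -
  have comp: "continuous_on (annulus a b) (\<lambda>x::real^'n. g (norm x))"
    if "continuous_on {a<..<b} g" for g :: "real \<Rightarrow> real"
    by (rule continuous_on_compose2[OF that continuous_on_norm_id]) (auto simp: annulus_def)
  have cf: "continuous_on {a<..<b} f" "continuous_on {a<..<b} f'"
    by (rule DERIV_continuous_on, rule has_field_derivative_at_within, rule f', simp, simp)
      (rule DERIV_continuous_on, rule has_field_derivative_at_within, rule f'', simp, simp)
  have pos: "r \<noteq> 0" if "r \<in> {a<..<b}" for r using that a by auto
  have coord: "continuous_on (annulus a b) (\<lambda>x::real^'n. x $ i)" for i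
    by (rule continuous_on_component[OF continuous_on_id])
  have quot1: "continuous_on (annulus a b) (\<lambda>x::real^'n. f' (norm x) / norm x)"
    by (rule comp, rule continuous_on_divide[OF cf(2) continuous_on_id]) (use pos in blast)
  have quot2: "continuous_on (annulus a b)
      (\<lambda>x::real^'n. f'' (norm x) / norm x - f' (norm x) / (norm x)\<^sup>2)"
    by (rule comp[where g = "\<lambda>r. f'' r / r - f' r / r\<^sup>2"],
        intro continuous_on_diff continuous_on_divide continuous_on_power cf cont continuous_on_id)
       (use pos in auto)
  have quot3: "continuous_on (annulus a b) (\<lambda>x::real^'n. x $ j / norm x)" for j
    by (rule continuous_on_divide[OF coord continuous_on_norm_id]) (use nonzero_annulus in auto)
  have cu: "continuous_on (annulus a b) u"
    using comp[OF cf(1)] radial continuous_on_cong[of "annulus a b" "annulus a b" u "\<lambda>x. f (norm x)"]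
    by simp
  have C1: "C1_on (annulus a b) u"
    by (rule C1_onI[OF cu has_partial_derivative_radial_function continuous_on_mult[OF quot1 coord]])
  have "C1_on (annulus a b) (partial_deriv i u)" for i
  proof (rule C1_onI[OF _ has_second_partial_derivative_radial])
    show "continuous_on (annulus a b) (partial_deriv i u)"
      using C1 by (simp add: C1_on_def)
    show "continuous_on (annulus a b) (\<lambda>x.
        (f'' (norm x) / norm x - f' (norm x) / (norm x)\<^sup>2) * (x $ j / norm x) * x $ i +
        (if j = i then 1 else 0) * (f' (norm x) / norm x))" for j
      by (intro continuous_on_add continuous_on_mult quot1 quot2 quot3 coord continuous_on_const)
  qed
  with C1 show ?thesis by (simp add: C2_on_def)
qed

end

text \<open>Along a coordinate axis the norm is the coordinate itself, so the partial derivatives in that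
direction are the one-dimensional derivatives of \<open>f\<close>. This recovers the regularity of the
radial representative, about which nothing is known a priori.\<close>

lemma radial_C2_derivatives:
  fixes u :: "real^'n::finite \<Rightarrow> real"
  assumes a: "0 < a" and C2: "C2_on (annulus a b) u"
    and radial: "\<And>x. x \<in> annulus a b \<Longrightarrow> u x = f (norm x)"
  obtains f' f'' where
    "\<And>r. a < r \<Longrightarrow> r < b \<Longrightarrow> (f has_real_derivative f' r) (at r)"
    "\<And>r. a < r \<Longrightarrow> r < b \<Longrightarrow> (f' has_real_derivative f'' r) (at r)"
proof -
  fix i :: 'n
  let ?e = "axis i 1 :: real^'n"
  have restrict: "(g has_real_derivative partial_deriv i v (r *\<^sub>R ?e)) (at r)"
    if C1: "C1_on (annulus a b) v" and g: "\<And>s. a < s \<Longrightarrow> s < b \<Longrightarrow> v (s *\<^sub>R ?e) = g s"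
      and r: "a < r" "r < b" for v g r
  proof -
    have "r *\<^sub>R ?e \<in> annulus a b" using r a by (simp add: annulus_def)
    then have "(\<lambda>t. v (r *\<^sub>R ?e + t *\<^sub>R ?e)) field_differentiable (at 0)"
      using C1 by (auto simp: C1_on_def partially_differentiable_def)
    then have "((\<lambda>t. v (r *\<^sub>R ?e + t *\<^sub>R ?e)) has_real_derivative partial_deriv i v (r *\<^sub>R ?e)) (at 0)"
      unfolding partial_deriv_def by (rule field_differentiable_derivI)
    moreover have ev: "\<forall>\<^sub>F t in nhds 0. v (r *\<^sub>R ?e + t *\<^sub>R ?e) = g (t + r)"
    proof -
      have "\<forall>\<^sub>F t in nhds 0. t \<in> {a - r<..<b - r}"
        by (rule eventually_nhds_in_open) (use r in auto)
      then show ?thesis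
      proof eventually_elim
        case (elim t)
        have "r *\<^sub>R ?e + t *\<^sub>R ?e = (t + r) *\<^sub>R ?e"
          by (simp add: scaleR_add_left)
        then show ?case using g[of "t + r"] elim by simp
      qed
    qed
    ultimately have "((\<lambda>t. g (t + r)) has_real_derivative partial_deriv i v (r *\<^sub>R ?e)) (at 0)"
      using DERIV_cong_ev[OF refl ev refl] by simp
    then show ?thesis using DERIV_shift[of g _ 0 r] by simp
  qed
  show thesis
  proof (rule that)
    show "(f has_real_derivative partial_deriv i u (r *\<^sub>R ?e)) (at r)" if "a < r" "r < b" for r
      by (rule restrict) (use that a C2 radial in \<open>auto simp: C2_on_def annulus_def\<close>)
    show "((\<lambda>r. partial_deriv i u (r *\<^sub>R ?e)) has_real_derivative
        partial_deriv i (partial_deriv i u) (r *\<^sub>R ?e)) (at r)" if "a < r" "r < b" for r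
      by (rule restrict) (use that C2 in \<open>auto simp: C2_on_def\<close>)
  qed
qed

section \<open>The harmonic coordinate\<close>

definition harmonic_coord :: "real \<Rightarrow> real \<Rightarrow> real \<Rightarrow> real \<Rightarrow> real" where
  "harmonic_coord n a b r = (r powr (2 - n) - b powr (2 - n)) / (a powr (2 - n) - b powr (2 - n))"

text \<open>The inverse of \<open>harmonic_coord\<close>; it runs from \<open>b\<close> down to \<open>a\<close>.\<close>

definition harmonic_radius :: "real \<Rightarrow> real \<Rightarrow> real \<Rightarrow> real \<Rightarrow> real" where
  "harmonic_radius n a b t =
     (b powr (2 - n) + (a powr (2 - n) - b powr (2 - n)) * t) powr (1 / (2 - n))"

text \<open>\<open>lift_deriv\<close> and \<open>lift_deriv2\<close> are the first two derivatives in \<open>r\<close> of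
\<open>g (harmonic_coord n a b r)\<close>, where \<open>g'\<close> and \<open>g''\<close> are the derivatives of \<open>g\<close>.\<close>

definition lift_deriv :: "real \<Rightarrow> real \<Rightarrow> real \<Rightarrow> (real \<Rightarrow> real) \<Rightarrow> real \<Rightarrow> real" where
  "lift_deriv n a b g' r =
     g' (harmonic_coord n a b r) *
       ((2 - n) * r powr (1 - n) / (a powr (2 - n) - b powr (2 - n)))"

definition lift_deriv2 ::
    "real \<Rightarrow> real \<Rightarrow> real \<Rightarrow> (real \<Rightarrow> real) \<Rightarrow> (real \<Rightarrow> real) \<Rightarrow> real \<Rightarrow> real" where
  "lift_deriv2 n a b g' g'' r =
     g'' (harmonic_coord n a b r) *
       ((2 - n) * r powr (1 - n) / (a powr (2 - n) - b powr (2 - n))) *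
       ((2 - n) * r powr (1 - n) / (a powr (2 - n) - b powr (2 - n))) +
     (2 - n) * ((1 - n) * r powr (1 - n - 1)) / (a powr (2 - n) - b powr (2 - n)) *
       g' (harmonic_coord n a b r)"

context
  fixes n a b :: real
  assumes n: "n > 2" and a: "0 < a" and ab: "a < b"
begin

abbreviation (input) "width \<equiv> a powr (2 - n) - b powr (2 - n)"

lemma width_pos: "width > 0"
  using powr_less_mono2_neg[of "2 - n" a b] n a ab by simp

lemma harmonic_coord_ends: "harmonic_coord n a b a = 1" "harmonic_coord n a b b = 0"
  using width_pos by (auto simp: harmonic_coord_def)

lemma harmonic_coord_in_unit:
  assumes "a \<le> r" "r \<le> b"
  shows "harmonic_coord n a b r \<in> {0..1}"
  using powr_mono2'[of "2 - n" a r] powr_mono2'[of "2 - n" r b] assms n a width_pos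
  by (auto simp: harmonic_coord_def divide_simps)

lemma harmonic_coord_in_open_unit:
  assumes "a < r" "r < b"
  shows "0 < harmonic_coord n a b r" "harmonic_coord n a b r < 1"
  using powr_less_mono2_neg[of "2 - n" a r] powr_less_mono2_neg[of "2 - n" r b] assms n a width_pos
  by (auto simp: harmonic_coord_def divide_simps)

lemma DERIV_harmonic_coord:
  assumes "r > 0"
  shows "(harmonic_coord n a b has_real_derivative (2 - n) * r powr (1 - n) / width) (at r)"
proof -
  have "((\<lambda>r. (r powr (2 - n) - b powr (2 - n)) / width) has_real_derivative
      ((2 - n) * r powr (2 - n - 1) - 0) / width) (at r)"
    by (intro DERIV_cdivide DERIV_diff has_real_derivative_powr DERIV_const assms)
  then show ?thesis unfolding harmonic_coord_def [abs_def] by simp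
qed

lemma harmonic_radius_coord:
  assumes "r > 0"
  shows "harmonic_radius n a b (harmonic_coord n a b r) = r"
  using width_pos assms n by (simp add: harmonic_radius_def harmonic_coord_def powr_powr)

lemma harmonic_radius_ends: "harmonic_radius n a b 0 = b" "harmonic_radius n a b 1 = a"
  using a ab n by (auto simp: harmonic_radius_def powr_powr)

lemma harmonic_radius_base_pos:
  assumes "t \<in> {0..1}"
  shows "b powr (2 - n) + width * t > 0"
proof -
  have "0 \<le> width * t" using width_pos assms by (intro mult_nonneg_nonneg) auto
  moreover have "b powr (2 - n) > 0" using a ab by simp
  ultimately show ?thesis by linarith
qed

lemma continuous_on_harmonic_radius: "continuous_on {0..1} (harmonic_radius n a b)"
  unfolding harmonic_radius_def [abs_def]
proof (rule continuous_on_powr)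
  show "continuous_on {0..1} (\<lambda>t. b powr (2 - n) + width * t)"
    by (intro continuous_on_add continuous_on_const continuous_on_mult_left continuous_on_id)
  show "\<forall>t\<in>{0..1}. b powr (2 - n) + width * t \<noteq> 0"
    using harmonic_radius_base_pos by fastforce
qed (rule continuous_on_const)

lemma harmonic_radius_decreasing:
  assumes "0 \<le> s" "s < t" "t \<le> 1"
  shows "harmonic_radius n a b t < harmonic_radius n a b s"
  unfolding harmonic_radius_def
  by (rule powr_less_mono2_neg) (use harmonic_radius_base_pos[of s] width_pos n assms in auto)

lemma harmonic_radius_between:
  assumes "0 < t" "t < 1"
  shows "a < harmonic_radius n a b t" "harmonic_radius n a b t < b"
  using harmonic_radius_decreasing[of 0 t] harmonic_radius_decreasing[of t 1] assms
    harmonic_radius_ends by auto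

lemma DERIV_harmonic_radius:
  assumes t: "0 < t" "t < 1"
  shows "(harmonic_radius n a b has_real_derivative
           width / (2 - n) * harmonic_radius n a b t powr (n - 1)) (at t)"
proof -
  let ?x = "b powr (2 - n) + width * t"
  have x: "?x > 0" by (rule harmonic_radius_base_pos) (use t in auto)
  have "((\<lambda>t. b powr (2 - n) + width * t) has_real_derivative 0 + width * 1) (at t)"
    by (intro DERIV_add DERIV_const DERIV_cmult DERIV_ident)
  from DERIV_chain2[OF has_real_derivative_powr[OF x] this]
  have "(harmonic_radius n a b has_real_derivative
      1 / (2 - n) * ?x powr (1 / (2 - n) - 1) * (0 + width * 1)) (at t)"
    unfolding harmonic_radius_def [abs_def] .
  moreover have "?x powr (1 / (2 - n) - 1) = harmonic_radius n a b t powr (n - 1)"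
  proof -
    have "1 / (2 - n) - 1 = 1 / (2 - n) * (n - 1)" using n by (simp add: field_simps)
    then show ?thesis by (simp add: harmonic_radius_def powr_powr)
  qed
  ultimately show ?thesis by (simp add: mult_ac)
qed

context
  fixes g g' g'' :: "real \<Rightarrow> real"
  assumes g': "\<And>t. 0 < t \<Longrightarrow> t < 1 \<Longrightarrow> (g has_real_derivative g' t) (at t)"
    and g'': "\<And>t. 0 < t \<Longrightarrow> t < 1 \<Longrightarrow> (g' has_real_derivative g'' t) (at t)"
begin

lemma DERIV_lift:
  assumes "a < r" "r < b"
  shows "((\<lambda>r. g (harmonic_coord n a b r)) has_real_derivative lift_deriv n a b g' r) (at r)"
  unfolding lift_deriv_def
  by (rule DERIV_chain2[OF g' DERIV_harmonic_coord])
     (use harmonic_coord_in_open_unit[OF assms] assms a in auto)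

lemma DERIV_lift_deriv:
  assumes "a < r" "r < b"
  shows "(lift_deriv n a b g' has_real_derivative lift_deriv2 n a b g' g'' r) (at r)"
proof -
  have r: "r > 0" using assms a by simp
  show ?thesis
    unfolding lift_deriv_def [abs_def] lift_deriv2_def
    by (intro DERIV_mult DERIV_cdivide DERIV_cmult has_real_derivative_powr r
          DERIV_chain2[OF g'' DERIV_harmonic_coord] harmonic_coord_in_open_unit assms)
qed

text \<open>The terms with \<open>g'\<close> cancel because \<open>r powr (2 - n)\<close> is a harmonic function of \<open>x\<close> in
dimension \<open>n\<close>.\<close>

lemma lift_laplacian:
  assumes "r > 0"
  shows "lift_deriv2 n a b g' g'' r + (n - 1) / r * lift_deriv n a b g' r =
     (n - 2)\<^sup>2 / width\<^sup>2 * g'' (harmonic_coord n a b r) / r powr (2 * (n - 1))"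
proof -
  have "r powr (1 - n - 1) = r powr (1 - n) / r powr 1"
    by (rule powr_diff)
  then have 1: "r powr (1 - n - 1) = r powr (1 - n) / r"
    using assms by simp
  have 2: "1 / r powr (2 * (n - 1)) = r powr (1 - n) * r powr (1 - n)"
    by (simp add: powr_minus_divide [symmetric] powr_add [symmetric] algebra_simps)
  have "lift_deriv2 n a b g' g'' r + (n - 1) / r * lift_deriv n a b g' r =
      (n - 2)\<^sup>2 / width\<^sup>2 * g'' (harmonic_coord n a b r) * (r powr (1 - n) * r powr (1 - n))"
    unfolding lift_deriv_def lift_deriv2_def 1
    using assms width_pos by (simp add: divide_simps) (simp add: algebra_simps power2_eq_square)
  then show ?thesis unfolding 2 [symmetric] by simp
qed

end

text \<open>The converse direction of the change of variables, for a nonlinearity \<open>h\<close>. Since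
\<open>harmonic_radius\<close> satisfies a first order equation whose right-hand side is a constant multiple of a power of itself,
its derivatives can be kept as powers of the radius throughout.\<close>

lemma transport_radial_ode:
  fixes f f' f'' :: "real \<Rightarrow> real"
  assumes f': "\<And>r. a < r \<Longrightarrow> r < b \<Longrightarrow> (f has_real_derivative f' r) (at r)"
    and f'': "\<And>r. a < r \<Longrightarrow> r < b \<Longrightarrow> (f' has_real_derivative f'' r) (at r)"
    and ode: "\<And>r. a < r \<Longrightarrow> r < b \<Longrightarrow>
      - (f'' r + (n - 1) / r * f' r) = (n - 2)\<^sup>2 * (h (f r) / r powr (2 * (n - 1)))"
    and t: "0 < t" "t < 1"
  shows "((\<lambda>t. f (harmonic_radius n a b t)) has_real_derivative
           f' (harmonic_radius n a b t) * (width / (2 - n) * harmonic_radius n a b t powr (n - 1))) (at t)"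
    and "((\<lambda>t. f' (harmonic_radius n a b t) * (width / (2 - n) * harmonic_radius n a b t powr (n - 1)))
           has_real_derivative - (width\<^sup>2 * h (f (harmonic_radius n a b t)))) (at t)"
proof -
  let ?r = "harmonic_radius n a b"
  note between = harmonic_radius_between[OF t]
  have r: "?r t > 0" using between a by simp
  show "((\<lambda>t. f (?r t)) has_real_derivative f' (?r t) * (width / (2 - n) * ?r t powr (n - 1))) (at t)"
    by (rule DERIV_chain2[OF f'[OF between] DERIV_harmonic_radius[OF t]])
  have "((\<lambda>t. f' (?r t) * (width / (2 - n) * ?r t powr (n - 1))) has_real_derivative
      f'' (?r t) * (width / (2 - n) * ?r t powr (n - 1)) * (width / (2 - n) * ?r t powr (n - 1)) +
      width / (2 - n) * ((n - 1) * ?r t powr (n - 1 - 1) * (width / (2 - n) * ?r t powr (n - 1))) * f' (?r t)) (at t)"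
    by (intro DERIV_mult DERIV_cmult DERIV_chain2[OF f''[OF between] DERIV_harmonic_radius[OF t]]
         DERIV_chain2[OF has_real_derivative_powr[OF r] DERIV_harmonic_radius[OF t]])
  moreover have "f'' (?r t) * (width / (2 - n) * ?r t powr (n - 1)) * (width / (2 - n) * ?r t powr (n - 1)) +
      width / (2 - n) * ((n - 1) * ?r t powr (n - 1 - 1) * (width / (2 - n) * ?r t powr (n - 1))) * f' (?r t)
      = - (width\<^sup>2 * h (f (?r t)))" (is "?lhs = _")
  proof -
    define P where "P = ?r t powr (n - 1)"
    have P: "P > 0" using r by (simp add: P_def)
    have "?r t powr (n - 1 - 1) = P / ?r t powr 1"
      unfolding P_def by (rule powr_diff)
    then have 1: "?r t powr (n - 1 - 1) = P / ?r t"
      using r by simp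
    have 2: "?r t powr (2 * (n - 1)) = P * P"
      by (simp add: P_def powr_add [symmetric])
    define c where "c = width / (2 - n)"
    have "?lhs = c\<^sup>2 * (P * P) * (f'' (?r t) + (n - 1) / ?r t * f' (?r t))"
      unfolding 1 P_def [symmetric] c_def [symmetric]
      by (simp add: distrib_left mult_ac power2_eq_square)
    also have "f'' (?r t) + (n - 1) / ?r t * f' (?r t) = - ((n - 2)\<^sup>2 * (h (f (?r t)) / (P * P)))"
      using ode[OF between] unfolding 2 by linarith
    also have "c\<^sup>2 * (P * P) * - ((n - 2)\<^sup>2 * (h (f (?r t)) / (P * P))) =
        - (width\<^sup>2 * h (f (?r t)) * ((n - 2)\<^sup>2 / (2 - n)\<^sup>2))"
      using P by (simp add: c_def power_divide)
    also have "(n - 2)\<^sup>2 / (2 - n)\<^sup>2 = 1"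
      using n by (simp add: power2_commute)
    finally show ?thesis by simp
  qed
  ultimately show "((\<lambda>t. f' (?r t) * (width / (2 - n) * ?r t powr (n - 1))) has_real_derivative
      - (width\<^sup>2 * h (f (?r t)))) (at t)"
    by (simp only:)
qed

end

section \<open>Radial solutions and their limits\<close>

definition amplitude :: "real \<Rightarrow> real \<Rightarrow> real" where
  "amplitude d p =
     (2 / d) powr (2 / (p - 1)) * ((p + 1) / 2) powr (1 / (p - 1)) * Lp p powr (2 / (p - 1))"

text \<open>The form in which the maximal value appears in the uniqueness argument.\<close>

lemma amplitude_eq:
  assumes "d > 0" "p > 1"
  shows "amplitude d p = (2 * (p + 1) * (Lp p)\<^sup>2 / d\<^sup>2) powr (1 / (p - 1))"
proof -
  have L: "Lp p > 0" using Lp_bounds(1)[of p] assms by simp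
  have sq: "x powr (2 / (p - 1)) = (x\<^sup>2) powr (1 / (p - 1))" if "x > 0" for x
  proof -
    have "(x powr 2) powr (1 / (p - 1)) = x powr (2 * (1 / (p - 1)))"
      by (rule powr_powr)
    then show ?thesis using that by simp
  qed
  have mult: "(x * y * z) powr q = x powr q * y powr q * z powr q" for x y z q :: real
    by (simp add: powr_mult)
  have "amplitude d p = ((2 / d)\<^sup>2 * ((p + 1) / 2) * (Lp p)\<^sup>2) powr (1 / (p - 1))"
    using mult[of "(2 / d)\<^sup>2" "(p + 1) / 2" "(Lp p)\<^sup>2"] assms L
    by (simp only: amplitude_def sq divide_pos_pos zero_less_numeral)
  also have "(2 / d)\<^sup>2 * ((p + 1) / 2) * (Lp p)\<^sup>2 = 2 * (p + 1) * (Lp p)\<^sup>2 / d\<^sup>2"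
    using assms by (simp add: power_divide field_simps)
  finally show ?thesis .
qed

lemma amplitude_pos:
  assumes "d > 0" "p > 1"
  shows "amplitude d p > 0"
  unfolding amplitude_eq[OF assms] using assms Lp_bounds(1)[of p] by simp

text \<open>The scaling relation that turns the equation of the profile into \<open>- w'' = d\<^sup>2 * w powr p\<close>.\<close>

lemma amplitude_powr:
  assumes "d > 0" "p > 1"
  shows "amplitude d p * (2 * (p + 1) * (Lp p)\<^sup>2) / d\<^sup>2 = amplitude d p powr p"
proof -
  let ?K = "amplitude d p"
  have "2 * (p + 1) * (Lp p)\<^sup>2 / d\<^sup>2 > 0"
    using assms Lp_bounds(1)[of p] by simp
  then have "?K powr (p - 1) = 2 * (p + 1) * (Lp p)\<^sup>2 / d\<^sup>2"
    unfolding amplitude_eq[OF assms] using assms by (simp add: powr_powr)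
  moreover have "?K powr (1 + (p - 1)) = ?K powr 1 * ?K powr (p - 1)"
    by (rule powr_add)
  ultimately show ?thesis
    using amplitude_pos[OF assms] by simp
qed

lemma amplitude_tendsto_1:
  assumes "d > 0"
  shows "(amplitude d \<longlongrightarrow> 1) at_top"
proof -
  have e: "((\<lambda>p::real. 2 / (p - 1)) \<longlongrightarrow> 0) at_top" by real_asymp
  have 1: "((\<lambda>p. (2 / d) powr (2 / (p - 1))) \<longlongrightarrow> (2 / d) powr 0) at_top"
    by (rule tendsto_powr[OF tendsto_const e]) (use assms in simp)
  have 2: "((\<lambda>p::real. ((p + 1) / 2) powr (1 / (p - 1))) \<longlongrightarrow> 1) at_top" by real_asymp
  have 3: "((\<lambda>p. Lp p powr (2 / (p - 1))) \<longlongrightarrow> 1 powr 0) at_top"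
    by (rule tendsto_powr[OF Lp_tendsto_1 e]) simp
  show ?thesis
    using tendsto_mult[OF tendsto_mult[OF 1 2] 3] assms
    unfolding amplitude_def [abs_def] by simp
qed

lemma nat_power_eq_powr_dim:
  assumes "N \<ge> 3" "(r::real) > 0"
  shows "r ^ (2 * (N - 1)) = r powr (2 * (real N - 1))"
proof -
  have "2 * (real N - 1) = real (2 * (N - 1))" using assms by (simp add: of_nat_diff)
  then show ?thesis by (simp only: powr_realpow[OF assms(2)])
qed

definition radial_profile :: "real \<Rightarrow> real \<Rightarrow> real \<Rightarrow> real^'n::finite \<Rightarrow> real" where
  "radial_profile a b p x =
     amplitude (a powr (2 - real CARD('n)) - b powr (2 - real CARD('n))) p *
     profile p (harmonic_coord (real CARD('n)) a b (norm x))"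

context
  fixes a b :: real and p :: real
  assumes dim: "CARD('n::finite) \<ge> 3" and a: "0 < a" and ab: "a < b" and p: "p > 1"
begin

lemma dim_gt_2: "real CARD('n) > 2"
  using dim by simp

text \<open>The profile in the harmonic coordinate is \<open>C\<^sup>2\<close> with explicit derivatives, so its Laplacian can
be read off; the amplitude is chosen such that the constants match.\<close>

lemma radial_profile_is_radial_solution:
  "is_radial_solution a b p (radial_profile a b p :: real^'n \<Rightarrow> real)"
proof -
  define n where "n = real CARD('n)"
  have n: "n > 2" using dim_gt_2 by (simp add: n_def)
  define d where "d = a powr (2 - n) - b powr (2 - n)"
  have d: "d > 0" using width_pos[OF n a ab] by (simp add: d_def)
  define K where "K = amplitude d p"
  have K: "K > 0" using amplitude_pos[OF d p] by (simp add: K_def)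
  have p1: "p \<ge> 1" using p by simp
  let ?u = "radial_profile a b p :: real^'n \<Rightarrow> real"
  define g where "g = (\<lambda>t. K * profile p t)"
  define g' where "g' = (\<lambda>t. K * profile_deriv p t)"
  define g'' where "g'' = (\<lambda>t. K * - (2 * (p + 1) * (Lp p)\<^sup>2 * profile p t powr p))"
  have u: "?u x = g (harmonic_coord n a b (norm x))" for x
    by (simp add: radial_profile_def g_def n_def d_def K_def)
  have dg: "(g has_real_derivative g' t) (at t)" if "0 < t" "t < 1" for t
    unfolding g_def g'_def by (intro DERIV_cmult DERIV_profile p1 that)
  have dg': "(g' has_real_derivative g'' t) (at t)" if "0 < t" "t < 1" for t
    unfolding g'_def g''_def by (intro DERIV_cmult DERIV_profile_deriv p1 that)
  note lift = DERIV_lift[OF n a ab dg dg'] DERIV_lift_deriv[OF n a ab dg dg']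
  have cont_coord: "continuous_on {a..b} (harmonic_coord n a b)"
    by (rule DERIV_continuous_on, rule has_field_derivative_at_within,
        rule DERIV_harmonic_coord[OF n a ab]) (use a in auto)
  have coord_unit: "harmonic_coord n a b ` {a..b} \<subseteq> {0..1}"
    using harmonic_coord_in_unit[OF n a ab] by auto
  have cont_prof: "continuous_on {a..b} (\<lambda>r. profile p (harmonic_coord n a b r))"
    by (rule continuous_on_compose2[OF continuous_on_profile[OF p1] cont_coord coord_unit])
  have cont2: "continuous_on {a<..<b} (lift_deriv2 n a b g' g'')"
  proof -
    have c1: "continuous_on {a<..<b} (harmonic_coord n a b)"
      by (rule continuous_on_subset[OF cont_coord]) auto
    have unit: "harmonic_coord n a b ` {a<..<b} \<subseteq> {0..1}"
      using coord_unit by auto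
    have "continuous_on {0..1} g'"
      unfolding g'_def by (intro continuous_on_mult_left continuous_on_profile_deriv p1)
    note cg' = continuous_on_compose2[OF this c1 unit]
    have "continuous_on {0..1} g''"
      unfolding g''_def
      by (intro continuous_on_mult_left continuous_on_minus continuous_on_profile_powr p1)
         (use p in simp)
    note cg'' = continuous_on_compose2[OF this c1 unit]
    have pw: "continuous_on {a<..<b} (\<lambda>r. r powr q)" for q :: real
      by (rule continuous_on_powr[OF continuous_on_id continuous_on_const]) (use a in auto)
    show ?thesis
      unfolding lift_deriv2_def [abs_def]
      by (intro continuous_on_add continuous_on_mult continuous_on_divide continuous_on_const
            cg' cg'' pw) (use d d_def in auto)
  qed
  have C2: "C2_on (annulus a b) ?u"
    by (rule C2_on_radial[OF a u lift cont2])
  have lap: "- laplacian ?u x =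
      (real CARD('n) - 2)\<^sup>2 * (?u x powr p / norm x ^ (2 * (CARD('n) - 1)))"
    if x: "x \<in> annulus a b" for x :: "real^'n"
  proof -
    have r: "norm x > 0" "a \<le> norm x" "norm x \<le> b" using x a by (auto simp: annulus_def)
    let ?t = "harmonic_coord n a b (norm x)"
    have phi: "profile p ?t \<ge> 0"
      using profile_in_unit[OF p1 harmonic_coord_in_unit[OF n a ab r(2,3)]] by simp
    have "laplacian ?u x = (n - 2)\<^sup>2 / d\<^sup>2 * g'' ?t / norm x powr (2 * (n - 1))"
      using laplacian_radial[OF a u lift x] lift_laplacian[OF n a ab dg dg' r(1)]
      by (simp add: n_def d_def)
    then have "- laplacian ?u x =
        (n - 2)\<^sup>2 * ((K * (2 * (p + 1) * (Lp p)\<^sup>2) / d\<^sup>2 * profile p ?t powr p) / norm x powr (2 * (n - 1)))"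
      by (simp add: g''_def mult_ac)
    also have "K * (2 * (p + 1) * (Lp p)\<^sup>2) / d\<^sup>2 = K powr p"
      unfolding K_def by (rule amplitude_powr[OF d p])
    also have "K powr p * profile p ?t powr p = ?u x powr p"
      unfolding u g_def using K phi by (simp add: powr_mult)
    finally show ?thesis
      unfolding nat_power_eq_powr_dim[OF dim r(1)] by (simp add: n_def)
  qed
  have pos: "?u x > 0" if "x \<in> annulus a b" for x
    unfolding u g_def using that K
    by (intro mult_pos_pos profile_pos p1 harmonic_coord_in_open_unit[OF n a ab])
       (auto simp: annulus_def)
  have bd: "?u x = 0" if "x \<in> frontier (annulus a b)" for x
  proof -
    have "norm x = a \<or> norm x = b" using that by (simp add: frontier_annulus[OF a ab])
    then have "profile p (harmonic_coord n a b (norm x)) = 0"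
      using harmonic_coord_ends[OF n a ab] profile_boundary[OF p1] by (elim disjE) simp_all
    then show ?thesis by (simp add: u g_def)
  qed
  have cont: "continuous_on (closure (annulus a b)) ?u"
    unfolding closure_annulus[OF a ab] u g_def
    by (intro continuous_on_mult_left continuous_on_compose2[OF cont_prof continuous_on_norm_id]) auto
  have "radially_symmetric_on (closure (annulus a b)) ?u"
    unfolding radially_symmetric_on_def
    by (intro exI[of _ "\<lambda>r. g (harmonic_coord n a b r)"]) (simp add: u)
  then show ?thesis
    unfolding is_radial_solution_def is_solution_def using C2 lap pos bd cont by blast
qed

text \<open>Pulling the radial representative back by \<open>harmonic_radius\<close> gives a positive solution of the
one-dimensional problem, which has been classified.\<close>

lemma radial_solution_unique:
  fixes v :: "real^'n \<Rightarrow> real"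
  assumes v: "is_radial_solution a b p v" and x: "x \<in> closure (annulus a b)"
  shows "v x = radial_profile a b p x"
proof -
  define n where "n = real CARD('n)"
  have n: "n > 2" using dim_gt_2 by (simp add: n_def)
  define d where "d = a powr (2 - n) - b powr (2 - n)"
  have d: "d > 0" using width_pos[OF n a ab] by (simp add: d_def)
  let ?A = "annulus a b :: (real^'n) set"
  let ?R = "harmonic_radius n a b"
  note cl = closure_annulus[OF a ab]
  obtain f where f: "\<And>x. x \<in> closure ?A \<Longrightarrow> v x = f (norm x)"
    using v by (auto simp: is_radial_solution_def radially_symmetric_on_def)
  have fA: "v x = f (norm x)" if "x \<in> ?A" for x
    using f that closure_subset by blast
  have sol: "C2_on ?A v" "continuous_on (closure ?A) v"
    "\<And>x. x \<in> ?A \<Longrightarrow> - laplacian v x = (n - 2)\<^sup>2 * (v x powr p / norm x ^ (2 * (CARD('n) - 1)))"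
    "\<And>x. x \<in> ?A \<Longrightarrow> v x > 0" "\<And>x. x \<in> frontier ?A \<Longrightarrow> v x = 0"
    using v by (auto simp: is_radial_solution_def is_solution_def n_def)
  obtain f' f'' where
    f': "\<And>r. a < r \<Longrightarrow> r < b \<Longrightarrow> (f has_real_derivative f' r) (at r)" and
    f'': "\<And>r. a < r \<Longrightarrow> r < b \<Longrightarrow> (f' has_real_derivative f'' r) (at r)"
    using radial_C2_derivatives[OF a sol(1) fA] by blast

  fix i :: 'n
  let ?e = "axis i 1 :: real^'n"
  have ray: "r *\<^sub>R ?e \<in> closure ?A" "norm (r *\<^sub>R ?e) = r" if "a \<le> r" "r \<le> b" for r
    using that a by (auto simp: cl)
  have ray_open: "r *\<^sub>R ?e \<in> ?A" "norm (r *\<^sub>R ?e) = r" if "a < r" "r < b" for r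
    using that a by (auto simp: annulus_def)
  have on_ray: "f r = v (r *\<^sub>R ?e)" if "a \<le> r" "r \<le> b" for r
    using f[OF ray(1)[OF that]] ray(2)[OF that] by simp
  have ode: "- (f'' r + (n - 1) / r * f' r) = (n - 2)\<^sup>2 * (f r powr p / r powr (2 * (n - 1)))"
    if r: "a < r" "r < b" for r
    using sol(3)[OF ray_open(1)[OF r]] laplacian_radial[OF a fA f' f'' ray_open(1)[OF r]]
      fA[OF ray_open(1)[OF r]] nat_power_eq_powr_dim[OF dim, of r] r a
    by (simp add: ray_open(2)[OF r] n_def)
  have cont_f: "continuous_on {a..b} f"
  proof -
    have "continuous_on {a..b} (\<lambda>r. r *\<^sub>R ?e)"
      by (intro continuous_on_scaleR continuous_on_id continuous_on_const)
    then have "continuous_on {a..b} (\<lambda>r. v (r *\<^sub>R ?e))"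
      by (rule continuous_on_compose2[OF sol(2)]) (use ray in auto)
    then show ?thesis
      using on_ray continuous_on_cong[of "{a..b}" "{a..b}" f "\<lambda>r. v (r *\<^sub>R ?e)"] by simp
  qed
  have R_range: "?R ` {0..1} \<subseteq> {a..b}"
  proof
    fix r assume "r \<in> ?R ` {0..1}"
    then obtain t where "t \<in> {0..1}" "r = ?R t" by blast
    then show "r \<in> {a..b}"
      using harmonic_radius_between[OF n a ab, of t] harmonic_radius_ends[OF n a ab] ab
      by (cases "t = 0 \<or> t = 1") auto
  qed
  let ?t = "harmonic_coord n a b (norm x)"
  have nx: "a \<le> norm x" "norm x \<le> b" using x by (auto simp: cl)
  have "f (?R ?t) = (2 * (p + 1) * (Lp p)\<^sup>2 / d\<^sup>2) powr (1 / (p - 1)) * profile p ?t"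
  proof (rule lane_emden_unit_interval[OF p])
    show "continuous_on {0..1} (\<lambda>t. f (?R t))"
      by (rule continuous_on_compose2[OF cont_f continuous_on_harmonic_radius[OF n a ab] R_range])
    have "f a = 0" "f b = 0"
      using sol(5)[of "a *\<^sub>R ?e"] sol(5)[of "b *\<^sub>R ?e"] on_ray[of a] on_ray[of b] ab a
      by (auto simp: frontier_annulus)
    then show "f (?R 0) = 0" "f (?R 1) = 0"
      by (auto simp: harmonic_radius_ends[OF n a ab])
    fix t :: real assume t: "0 < t" "t < 1"
    note between = harmonic_radius_between[OF n a ab t]
    show "f (?R t) > 0"
      using sol(4)[OF ray_open(1)[OF between]] on_ray[of "?R t"] between by simp
    show "((\<lambda>t. f (?R t)) has_real_derivative
        f' (?R t) * (d / (2 - n) * ?R t powr (n - 1))) (at t)"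
      unfolding d_def
      by (rule transport_radial_ode(1)[where h = "\<lambda>y. y powr p", OF n a ab f' f'' ode t])
    show "((\<lambda>t. f' (?R t) * (d / (2 - n) * ?R t powr (n - 1))) has_real_derivative
        - (d\<^sup>2 * f (?R t) powr p)) (at t)"
      unfolding d_def
      by (rule transport_radial_ode(2)[where h = "\<lambda>y. y powr p", OF n a ab f' f'' ode t])
  qed (use d harmonic_coord_in_unit[OF n a ab nx] in auto)
  moreover have "?R ?t = norm x"
    using nx a by (intro harmonic_radius_coord[OF n a ab]) linarith
  ultimately show ?thesis
    unfolding radial_profile_def n_def [symmetric] d_def [symmetric] amplitude_eq[OF d p] f[OF x]
    by simp
qed

end

lemma uniform_limit_from_bound:
  fixes f :: "'c \<Rightarrow> 'd \<Rightarrow> real"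
  assumes "\<forall>\<^sub>F p in F. \<forall>x\<in>S. \<bar>f p x - l x\<bar> \<le> B p" and "(B \<longlongrightarrow> 0) F"
  shows "uniform_limit S f l F"
proof (rule uniform_limitI)
  fix e :: real assume "e > 0"
  then have "\<forall>\<^sub>F p in F. B p < e" using assms(2) by (rule order_tendstoD(2)[rotated])
  with assms(1) show "\<forall>\<^sub>F p in F. \<forall>x\<in>S. dist (f p x) (l x) < e"
    by eventually_elim (force simp: dist_real_def)
qed

text \<open>The threshold radius is the one where \<open>r powr (2 - n)\<close> equals the mean of its boundary values,
that is, where the harmonic coordinate is \<open>1/2\<close>; negative exponents reverse the order.\<close>

lemma tent_in_harmonic_coord:
  assumes n: "n > 2" and r: "0 < a" "a < b" "a \<le> r"
  shows "2 / (a powr (2 - n) - b powr (2 - n)) *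
      (if r \<le> ((a powr (2 - n) + b powr (2 - n)) / 2) powr (1 / (2 - n))
       then a powr (2 - n) - r powr (2 - n) else r powr (2 - n) - b powr (2 - n)) =
     2 * min (harmonic_coord n a b r) (1 - harmonic_coord n a b r)"
proof -
  define A where "A = a powr (2 - n)"
  define B where "B = b powr (2 - n)"
  define R where "R = r powr (2 - n)"
  have d: "A - B > 0" using width_pos[OF n r(1,2)] by (simp add: A_def B_def)
  have pos: "(A + B) / 2 > 0" using r by (simp add: A_def B_def add_pos_pos)
  have rR: "r = R powr (1 / (2 - n))"
    using r n by (simp add: R_def powr_powr)
  have "R > 0" using r by (simp add: R_def)
  have "r \<le> ((A + B) / 2) powr (1 / (2 - n)) \<longleftrightarrow> (A + B) / 2 \<le> R"
  proof
    assume "(A + B) / 2 \<le> R"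
    then show "r \<le> ((A + B) / 2) powr (1 / (2 - n))"
      unfolding rR using pos n by (intro powr_mono2') auto
  next
    assume le: "r \<le> ((A + B) / 2) powr (1 / (2 - n))"
    show "(A + B) / 2 \<le> R"
    proof (rule ccontr)
      assume "\<not> (A + B) / 2 \<le> R"
      then have "((A + B) / 2) powr (1 / (2 - n)) < R powr (1 / (2 - n))"
        using \<open>R > 0\<close> n by (intro powr_less_mono2_neg) auto
      then show False using le rR by simp
    qed
  qed
  moreover have "harmonic_coord n a b r = (R - B) / (A - B)"
    by (simp add: harmonic_coord_def A_def B_def R_def)
  moreover have "1 - (R - B) / (A - B) = (A - R) / (A - B)"
    using d by (simp add: field_simps)
  moreover have "(A - R) / (A - B) \<le> (R - B) / (A - B) \<longleftrightarrow> (A + B) / 2 \<le> R"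
    using d by (simp add: divide_le_cancel) (auto simp: field_simps)
  ultimately show ?thesis
    unfolding A_def [symmetric] B_def [symmetric] R_def [symmetric]
    by (auto simp: min_def)
qed

theorem theorem2:
  fixes a b :: real and N :: nat
  assumes "N = CARD('n::finite)" and "N \<ge> 3" and "0 < a" and "a < b"
  shows "\<exists>u :: real \<Rightarrow> real^'n \<Rightarrow> real.
    (\<forall>p>1. is_radial_solution a b p (u p) \<and>
       (\<forall>v. is_radial_solution a b p v \<longrightarrow>
          (\<forall>x\<in>closure (annulus a b). v x = u p x))) \<and>
    uniform_limit (closure (annulus a b)) u
      (\<lambda>x. 2 / (a powr (2 - real N) - b powr (2 - real N)) *
        (if norm x \<le> ((a powr (2 - real N) + b powr (2 - real N)) / 2) powr (1 / (2 - real N))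
         then a powr (2 - real N) - norm x powr (2 - real N)
         else norm x powr (2 - real N) - b powr (2 - real N)))
      at_top \<and>
    (\<exists>\<omega> :: real \<Rightarrow> real^'n \<Rightarrow> real.
       uniform_limit (closure (annulus a b)) \<omega> (\<lambda>x. 0) (at_right 1) \<and>
       (\<forall>p>1. \<forall>x\<in>closure (annulus a b).
          u p x =
            (2 / (a powr (2 - real N) - b powr (2 - real N))) powr (2 / (p - 1)) *
            ((p + 1) / 2) powr (1 / (p - 1)) * Lp p powr (2 / (p - 1)) *
            (sin (pi * (norm x powr (2 - real N) - b powr (2 - real N)) /
                  (a powr (2 - real N) - b powr (2 - real N))) + \<omega> p x)))"
proof (rule exI[of _ "radial_profile a b"], intro conjI allI impI ballI)
  note a = assms(3) and ab = assms(4)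
  have N: "real N > 2" and dim: "CARD('n) \<ge> 3" using assms by auto
  define d where "d = a powr (2 - real N) - b powr (2 - real N)"
  have d: "d > 0" using width_pos[OF N a ab] by (simp add: d_def)
  let ?t = "\<lambda>x::real^'n. harmonic_coord (real N) a b (norm x)"
  let ?A = "annulus a b :: (real^'n) set"
  have t: "?t x \<in> {0..1}" if "x \<in> closure ?A" for x
    using that harmonic_coord_in_unit[OF N a ab] by (simp add: closure_annulus[OF a ab])
  have u: "radial_profile a b p x = amplitude d p * profile p (?t x)" for p and x :: "real^'n"
    by (simp add: radial_profile_def d_def assms(1))
  show "is_radial_solution a b p (radial_profile a b p :: real^'n \<Rightarrow> real)" if "p > 1" for p
    by (rule radial_profile_is_radial_solution[OF dim a ab that])
  show "v x = radial_profile a b p x"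
    if "p > 1" "is_radial_solution a b p v" "x \<in> closure ?A" for p v x
    by (rule radial_solution_unique[OF dim a ab that])

  show "uniform_limit (closure ?A) (radial_profile a b)
      (\<lambda>x. 2 / (a powr (2 - real N) - b powr (2 - real N)) *
        (if norm x \<le> ((a powr (2 - real N) + b powr (2 - real N)) / 2) powr (1 / (2 - real N))
         then a powr (2 - real N) - norm x powr (2 - real N)
         else norm x powr (2 - real N) - b powr (2 - real N))) at_top"
    (is "uniform_limit _ _ ?tent _")
  proof (rule uniform_limit_from_bound)
    show "\<forall>\<^sub>F p in at_top. \<forall>x\<in>closure ?A. \<bar>radial_profile a b p x - ?tent x\<bar> \<le>
        \<bar>amplitude d p - 1\<bar> + 2 * (Lp p - 1)"
      using eventually_gt_at_top[of 1]
    proof eventually_elim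
      case (elim p)
      then have p1: "p \<ge> 1" by simp
      show ?case
      proof
        fix x assume x: "x \<in> closure ?A"
        let ?phi = "profile p (?t x)"
        have tent: "?tent x = 2 * min (?t x) (1 - ?t x)"
          by (rule tent_in_harmonic_coord[OF N a ab])
             (use x in \<open>auto simp: closure_annulus[OF a ab]\<close>)
        have "radial_profile a b p x - ?tent x =
            (amplitude d p - 1) * ?phi + (?phi - 2 * min (?t x) (1 - ?t x))"
          unfolding tent u by (simp add: algebra_simps)
        moreover have "\<bar>(amplitude d p - 1) * ?phi\<bar> \<le> \<bar>amplitude d p - 1\<bar>"
          using profile_in_unit[OF p1 t[OF x]] by (simp add: abs_mult mult_left_le)
        moreover note profile_near_tent[OF p1 t[OF x]]
        ultimately show "\<bar>radial_profile a b p x - ?tent x\<bar> \<le> \<bar>amplitude d p - 1\<bar> + 2 * (Lp p - 1)"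
          by linarith
      qed
    qed
    have "((\<lambda>p. \<bar>amplitude d p - 1\<bar> + 2 * (Lp p - 1)) \<longlongrightarrow> \<bar>1 - 1\<bar> + 2 * (1 - 1)) at_top"
      by (intro tendsto_intros amplitude_tendsto_1 Lp_tendsto_1 d)
    then show "((\<lambda>p. \<bar>amplitude d p - 1\<bar> + 2 * (Lp p - 1)) \<longlongrightarrow> 0) at_top" by simp
  qed

  show "\<exists>\<omega> :: real \<Rightarrow> real^'n \<Rightarrow> real.
       uniform_limit (closure ?A) \<omega> (\<lambda>x. 0) (at_right 1) \<and>
       (\<forall>p>1. \<forall>x\<in>closure ?A.
          radial_profile a b p x =
            (2 / (a powr (2 - real N) - b powr (2 - real N))) powr (2 / (p - 1)) *
            ((p + 1) / 2) powr (1 / (p - 1)) * Lp p powr (2 / (p - 1)) *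
            (sin (pi * (norm x powr (2 - real N) - b powr (2 - real N)) /
                  (a powr (2 - real N) - b powr (2 - real N))) + \<omega> p x))"
  proof (rule exI[of _ "\<lambda>p x. profile p (?t x) - sin (pi * ?t x)"], intro conjI allI impI ballI)
    show "uniform_limit (closure ?A) (\<lambda>p x. profile p (?t x) - sin (pi * ?t x)) (\<lambda>x. 0) (at_right 1)"
    proof (rule uniform_limit_from_bound)
      show "\<forall>\<^sub>F p in at_right 1. \<forall>x\<in>closure ?A.
          \<bar>profile p (?t x) - sin (pi * ?t x) - 0\<bar> \<le> 2 * (pi / 2 - Lp p)"
        using eventually_at_right_less[of "1::real"]
        by eventually_elim (use profile_near_sin t in auto)
      have "((\<lambda>p. 2 * (pi / 2 - Lp p)) \<longlongrightarrow> 2 * (pi / 2 - pi / 2)) (at_right 1)"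
        by (intro tendsto_intros Lp_tendsto_pi_half)
      then show "((\<lambda>p. 2 * (pi / 2 - Lp p)) \<longlongrightarrow> 0) (at_right 1)" by simp
    qed
    show "radial_profile a b p x =
            (2 / (a powr (2 - real N) - b powr (2 - real N))) powr (2 / (p - 1)) *
            ((p + 1) / 2) powr (1 / (p - 1)) * Lp p powr (2 / (p - 1)) *
            (sin (pi * (norm x powr (2 - real N) - b powr (2 - real N)) /
                  (a powr (2 - real N) - b powr (2 - real N))) +
             (profile p (?t x) - sin (pi * ?t x)))" for p and x :: "real^'n"
      unfolding u amplitude_def d_def harmonic_coord_def by simp
  qed
qed

end
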